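(* The following three assertions hold. **1.** Let $R=\bigoplus_{n\in\mathbb{N}_0}R_n$ be a graded ring which is generalized anticommutative, homogeneously faithful, and has no additively $2$-torsion elements. Then $R$ is centrally essential if and only if either $R=R_0$ or there exists an odd positive integer $n$ such that $R_n\neq 0$ and $R_{n+1}=0$. **2.** Let $F$ be a field of characteristic $0$ or $p\neq 2$ and let $V$ be a finite-dimensional vector space over $F$ with $\dim V>0$. The exterior algebra $\Lambda(V)$ is a centrally essential ring if and only if $\dim V$ is an odd positive integer. In particular, if $F$ is a finite field of odd characteristic and $\dim V$ is an odd positive integer exceeding $1$, then $\Lambda(V)$ is a centrally essential noncommutative finite ring. **3.** There exist noncommutative centrally essential finite rings.
   Context: All rings are associative and unital. $\mathbb{N}_0=\mathbb{N}\cup\{0\}$ denotes the non-negative integers. A ring $R$ with center $C$ is *centrally essential* if the module $R_C$ ($R$ regarded as a module over its center $C$) is an essential extension of $C_C$, i.e. every nonzero $C$-submodule of $R$ meets $C$ nontrivially; equivalently, for every $r\in R\setminus\{0\}$ there exists $c\in C$ with $rc\in C\setminus\{0\}$. A *graded ring* is a ring $R$ which is the direct sum $R=\bigoplus_{n\in\mathbb{N}_0}R_n$ of additive subgroups with $R_mR_n\subseteq R_{m+n}$ for all $m,n\in\mathbb{N}_0$. A graded ring is *generalized anticommutative* if for all $m,n\in\mathbb{N}_0$ and all $x\in R_m$, $y\in R_n$ one has $yx=(-1)^{mn}xy$. A graded ring is *homogeneously faithful* if for all $m,n\in\mathbb{N}_0$: if $R_{m+n}\neq 0$, then $R_m\neq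 0$ and $xR_n\neq 0$ for every $x\in R_m\setminus\{0\}$. "Without additively $2$-torsion elements" means that $2x=0$ with $x\in R$ implies $x=0$. For a vector space $V$ with basis $e_1,\ldots,e_n$ over a field $F$ of characteristic different from $2$, the exterior algebra $\Lambda(V)$ is the unital associative $F$-algebra, with multiplication $\wedge$, given by generators $e_1,\ldots,e_n$ and defining relations $e_i\wedge e_j+e_j\wedge e_i=0$ for all $i,j\in\{1,\ldots,n\}$. *)

theory Defs
  imports "HOL-Algebra.Algebra"
begin

definition ring_center :: "('a, 'm) ring_scheme \<Rightarrow> 'a set" where
  "ring_center R = {c \<in> carrier R. \<forall>x \<in> carrier R. c \<otimes>\<^bsub>R\<^esub> x = x \<otimes>\<^bsub>R\<^esub> c}"

text \<open>The sets \<open>N\<close> below are exactly the submodules of \<open>R\<close> regarded as a right module over its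
  center \<open>C\<close>, so the condition says that \<open>R\<close> is an essential extension of \<open>C\<close> as a \<open>C\<close>-module.\<close>

definition centrally_essential :: "('a, 'm) ring_scheme \<Rightarrow> bool" where
  "centrally_essential R \<longleftrightarrow> ring R \<and>
     (\<forall>N. additive_subgroup N R \<and> (\<forall>x \<in> N. \<forall>c \<in> ring_center R. x \<otimes>\<^bsub>R\<^esub> c \<in> N) \<and> N \<noteq> {\<zero>\<^bsub>R\<^esub>}
        \<longrightarrow> N \<inter> ring_center R \<noteq> {\<zero>\<^bsub>R\<^esub>})"

lemma (in ring) additive_subgroup_center: "additive_subgroup (ring_center R) R"
proof (rule additive_subgroup.intro, rule add.subgroupI)
  show "ring_center R \<subseteq> carrier R" by (auto simp: ring_center_def)
  have "\<zero> \<in> ring_center R" by (auto simp: ring_center_def)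
  then show "ring_center R \<noteq> {}" by blast
  show "\<ominus> a \<in> ring_center R" if "a \<in> ring_center R" for a
    using that by (auto simp: ring_center_def l_minus r_minus)
  show "a \<oplus> b \<in> ring_center R" if "a \<in> ring_center R" "b \<in> ring_center R" for a b
    using that by (auto simp: ring_center_def l_distr r_distr)
qed

lemma (in ring) centrally_essential_iff:
  "centrally_essential R \<longleftrightarrow>
     (\<forall>r \<in> carrier R - {\<zero>}. \<exists>c \<in> ring_center R. r \<otimes> c \<in> ring_center R - {\<zero>})"
proof
  assume ce: "centrally_essential R"
  note C_zero = additive_subgroup.zero_closed[OF additive_subgroup_center]
    and C_add = additive_subgroup.a_closed[OF additive_subgroup_center]
    and C_minus = additive_subgroup.a_inv_closed[OF additive_subgroup_center]
  have C_sub: "c \<in> carrier R" if "c \<in> ring_center R" for c using that by (auto simp: ring_center_def)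
  have C_one: "\<one> \<in> ring_center R" by (auto simp: ring_center_def)
  have C_mult: "c \<otimes> d \<in> ring_center R" if "c \<in> ring_center R" "d \<in> ring_center R" for c d
    unfolding ring_center_def
  proof (intro CollectI conjI ballI)
    have cd: "c \<in> carrier R" "d \<in> carrier R" using that C_sub by auto
    then show "c \<otimes> d \<in> carrier R" by simp
    fix x assume x: "x \<in> carrier R"
    have "d \<otimes> x = x \<otimes> d" "c \<otimes> x = x \<otimes> c" using that x unfolding ring_center_def by blast+
    then have "c \<otimes> d \<otimes> x = c \<otimes> (x \<otimes> d)" using x cd m_assoc by metis
    also have "\<dots> = c \<otimes> x \<otimes> d" using x cd by (simp add: m_assoc)
    also have "\<dots> = x \<otimes> (c \<otimes> d)" using \<open>c \<otimes> x = x \<otimes> c\<close> x cd m_assoc by metis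
    finally show "c \<otimes> d \<otimes> x = x \<otimes> (c \<otimes> d)" .
  qed
  show "\<forall>r \<in> carrier R - {\<zero>}. \<exists>c \<in> ring_center R. r \<otimes> c \<in> ring_center R - {\<zero>}"
  proof
    fix r assume r: "r \<in> carrier R - {\<zero>}"
    define N where "N = (\<lambda>c. r \<otimes> c) ` ring_center R"
    have "additive_subgroup N R"
    proof (rule additive_subgroup.intro, rule add.subgroupI)
      show "N \<subseteq> carrier R" using r C_sub by (auto simp: N_def)
      show "N \<noteq> {}" using C_one by (auto simp: N_def)
      show "\<ominus> a \<in> N" if "a \<in> N" for a
      proof -
        from that obtain c where c: "c \<in> ring_center R" "a = r \<otimes> c" by (auto simp: N_def)
        have "\<ominus> a = r \<otimes> (\<ominus> c)" using c r C_sub by (simp add: r_minus)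
        moreover have "\<ominus> c \<in> ring_center R" using c by (simp add: C_minus)
        ultimately show ?thesis unfolding N_def by blast
      qed
      show "a \<oplus> b \<in> N" if ab: "a \<in> N" "b \<in> N" for a b
      proof -
        from ab obtain c d where cd: "c \<in> ring_center R" "a = r \<otimes> c" "d \<in> ring_center R" "b = r \<otimes> d"
          by (auto simp: N_def)
        have "a \<oplus> b = r \<otimes> (c \<oplus> d)" using cd r C_sub by (simp add: r_distr)
        moreover have "c \<oplus> d \<in> ring_center R" using cd by (simp add: C_add)
        ultimately show ?thesis unfolding N_def by auto
      qed
    qed
    moreover have "\<forall>x \<in> N. \<forall>c \<in> ring_center R. x \<otimes> c \<in> N"
      using r C_sub C_mult by (auto simp: N_def m_assoc)
    moreover have "r \<in> N" unfolding N_def using r C_one by (intro image_eqI[of _ _ \<one>]) auto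
    ultimately have "N \<inter> ring_center R \<noteq> {\<zero>}" using ce r unfolding centrally_essential_def by blast
    moreover have "\<zero> \<in> N \<inter> ring_center R"
      using \<open>additive_subgroup N R\<close> by (simp add: additive_subgroup.zero_closed C_zero)
    ultimately show "\<exists>c \<in> ring_center R. r \<otimes> c \<in> ring_center R - {\<zero>}"
      unfolding N_def by blast
  qed
next
  assume *: "\<forall>r \<in> carrier R - {\<zero>}. \<exists>c \<in> ring_center R. r \<otimes> c \<in> ring_center R - {\<zero>}"
  show "centrally_essential R"
    unfolding centrally_essential_def
  proof (intro conjI allI impI, rule ring_axioms)
    fix N assume N: "additive_subgroup N R \<and> (\<forall>x\<in>N. \<forall>c\<in>ring_center R. x \<otimes> c \<in> N) \<and> N \<noteq> {\<zero>}"
    then have "\<zero> \<in> N" "N \<subseteq> carrier R"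
      by (simp_all add: additive_subgroup.zero_closed additive_subgroup.a_subset)
    with N obtain r where "r \<in> N" "r \<in> carrier R - {\<zero>}" by blast
    with * N show "N \<inter> ring_center R \<noteq> {\<zero>}" by blast
  qed
qed

locale graded_ring = ring R for R (structure) +
  fixes G :: "nat \<Rightarrow> 'a set"
  assumes additive_subgroup_component: "additive_subgroup (G n) R"
    and direct_sum: "x \<in> carrier R \<Longrightarrow>
      \<exists>!f. (\<forall>n. f n \<in> G n) \<and> finite {n. f n \<noteq> \<zero>} \<and> x = (\<Oplus>n\<in>{n. f n \<noteq> \<zero>}. f n)"
    and mult_component: "x \<in> G m \<Longrightarrow> y \<in> G n \<Longrightarrow> x \<otimes> y \<in> G (m + n)"

definition generalized_anticommutative :: "('a, 'm) ring_scheme \<Rightarrow> (nat \<Rightarrow> 'a set) \<Rightarrow> bool" where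
  "generalized_anticommutative R G \<longleftrightarrow>
     (\<forall>m n. \<forall>x \<in> G m. \<forall>y \<in> G n.
        y \<otimes>\<^bsub>R\<^esub> x = (\<ominus>\<^bsub>R\<^esub> \<one>\<^bsub>R\<^esub>) [^]\<^bsub>R\<^esub> (m * n) \<otimes>\<^bsub>R\<^esub> (x \<otimes>\<^bsub>R\<^esub> y))"

definition homogeneously_faithful :: "('a, 'm) ring_scheme \<Rightarrow> (nat \<Rightarrow> 'a set) \<Rightarrow> bool" where
  "homogeneously_faithful R G \<longleftrightarrow>
     (\<forall>m n. G (m + n) \<noteq> {\<zero>\<^bsub>R\<^esub>} \<longrightarrow>
        G m \<noteq> {\<zero>\<^bsub>R\<^esub>} \<and> (\<forall>x \<in> G m - {\<zero>\<^bsub>R\<^esub>}. (\<lambda>y. x \<otimes>\<^bsub>R\<^esub> y) ` G n \<noteq> {\<zero>\<^bsub>R\<^esub>}))"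

definition no_additive_2_torsion :: "('a, 'm) ring_scheme \<Rightarrow> bool" where
  "no_additive_2_torsion R \<longleftrightarrow>
     (\<forall>x \<in> carrier R. x \<oplus>\<^bsub>R\<^esub> x = \<zero>\<^bsub>R\<^esub> \<longrightarrow> x = \<zero>\<^bsub>R\<^esub>)"

text \<open>The free unital associative algebra on the set \<open>B\<close> of generators over the field \<open>'f\<close>: its
  elements are the finitely supported coefficient functions on words over \<open>B\<close>, and words are
  multiplied by concatenation.\<close>

definition free_algebra :: "'v set \<Rightarrow> ('v list \<Rightarrow> 'f::field) ring" where
  "free_algebra B =
     \<lparr>carrier = {f. finite {w. f w \<noteq> 0} \<and> {w. f w \<noteq> 0} \<subseteq> lists B},
      monoid.mult = (\<lambda>f g w. \<Sum>k\<le>length w. f (take k w) * g (drop k w)),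
      one = (\<lambda>w. if w = [] then 1 else 0),
      ring.zero = (\<lambda>w. 0),
      ring.add = (\<lambda>f g w. f w + g w)\<rparr>"

definition free_gen :: "'v \<Rightarrow> 'v list \<Rightarrow> 'f::field" where
  "free_gen b = (\<lambda>w. if w = [b] then 1 else 0)"

text \<open>For a vector space \<open>V\<close> with basis \<open>B\<close>, this is the algebra given by generators \<open>B\<close> and
  relations \<open>i \<and> j + j \<and> i = 0\<close> for \<open>i, j \<in> B\<close> (including \<open>i = j\<close>). A two-sided ideal of the
  free algebra is automatically closed under scalars, so the ring ideal is the algebra ideal.\<close>

definition exterior_algebra :: "'v set \<Rightarrow> ('v list \<Rightarrow> 'f::field) set ring" where
  "exterior_algebra B =
     free_algebra B Quot
       (Idl\<^bsub>free_algebra B\<^esub>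
          {free_gen i \<otimes>\<^bsub>free_algebra B\<^esub> free_gen j \<oplus>\<^bsub>free_algebra B\<^esub>
             free_gen j \<otimes>\<^bsub>free_algebra B\<^esub> free_gen i | i j. i \<in> B \<and> j \<in> B})"

lemma free_algebra_mult_assoc:
  fixes f g h :: "'v list \<Rightarrow> 'f::field"
  shows "(\<Sum>k\<le>length w. (\<Sum>j\<le>length (take k w). f (take j (take k w)) * g (drop j (take k w))) * h (drop k w))
       = (\<Sum>j\<le>length w. f (take j w) * (\<Sum>i\<le>length (drop j w). g (take i (drop j w)) * h (drop i (drop j w))))"
    (is "?L = ?R")
proof -
  have "?L = (\<Sum>k\<le>length w. \<Sum>j\<le>k. f (take j w) * g (drop j (take k w)) * h (drop k w))"
    by (intro sum.cong) (auto simp: sum_distrib_right min_def intro!: sum.cong)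
  also have "\<dots> = (\<Sum>(k, j)\<in>(SIGMA k:{..length w}. {..k}). f (take j w) * g (drop j (take k w)) * h (drop k w))"
    by (subst sum.Sigma) auto
  also have "\<dots> = (\<Sum>(j, i)\<in>(SIGMA j:{..length w}. {..length w - j}).
      f (take j w) * (g (take i (drop j w)) * h (drop i (drop j w))))"
    by (rule sum.reindex_bij_witness[where i = "\<lambda>(j, i). (i + j, j)" and j = "\<lambda>(k, j). (j, k - j)"])
       (auto simp: drop_take mult.assoc)
  also have "\<dots> = ?R" by (subst sum.Sigma[symmetric]) (auto simp: sum_distrib_left)
  finally show ?thesis .
qed

lemma free_algebra_mult_closed:
  fixes f g :: "'v list \<Rightarrow> 'f::field"
  assumes "f \<in> carrier (free_algebra B)" "g \<in> carrier (free_algebra B)"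
  shows "f \<otimes>\<^bsub>free_algebra B\<^esub> g \<in> carrier (free_algebra B)"
proof -
  let ?S = "(\<lambda>(u, v). u @ v) ` ({w. f w \<noteq> 0} \<times> {w. g w \<noteq> 0})"
  have "{w. (f \<otimes>\<^bsub>free_algebra B\<^esub> g) w \<noteq> 0} \<subseteq> ?S"
  proof
    fix w assume "w \<in> {w. (f \<otimes>\<^bsub>free_algebra B\<^esub> g) w \<noteq> 0}"
    then obtain k where "f (take k w) * g (drop k w) \<noteq> 0"
      by (auto simp: free_algebra_def elim!: sum.not_neutral_contains_not_neutral)
    then show "w \<in> ?S" by (intro image_eqI[of _ _ "(take k w, drop k w)"]) auto
  qed
  moreover have "finite ?S" using assms by (simp add: free_algebra_def)
  moreover have "?S \<subseteq> lists B" using assms by (fastforce simp: free_algebra_def)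
  ultimately have "finite {w. (f \<otimes>\<^bsub>free_algebra B\<^esub> g) w \<noteq> 0}"
    "{w. (f \<otimes>\<^bsub>free_algebra B\<^esub> g) w \<noteq> 0} \<subseteq> lists B"
    by (meson finite_subset, meson subset_trans)
  then show ?thesis by (simp add: free_algebra_def)
qed

lemma ring_free_algebra: "ring (free_algebra B :: ('v list \<Rightarrow> 'f::field) ring)"
proof (rule ringI)
  let ?A = "free_algebra B :: ('v list \<Rightarrow> 'f) ring"
  show "abelian_group ?A"
  proof (rule abelian_groupI)
    show "x \<oplus>\<^bsub>?A\<^esub> y \<in> carrier ?A" if "x \<in> carrier ?A" "y \<in> carrier ?A" for x y
    proof -
      have "{w. x w + y w \<noteq> 0} \<subseteq> {w. x w \<noteq> 0} \<union> {w. y w \<noteq> 0}" by auto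
      with that show ?thesis
        by (auto simp: free_algebra_def intro: finite_subset[of _ "{w. x w \<noteq> 0} \<union> {w. y w \<noteq> 0}"])
    qed
    show "\<exists>y\<in>carrier ?A. y \<oplus>\<^bsub>?A\<^esub> x = \<zero>\<^bsub>?A\<^esub>" if "x \<in> carrier ?A" for x
      using that by (intro bexI[of _ "\<lambda>w. - x w"]) (auto simp: free_algebra_def)
  qed (auto simp: free_algebra_def add_ac)
  show "monoid ?A"
  proof (rule monoidI)
    show "\<one>\<^bsub>?A\<^esub> \<in> carrier ?A" by (auto simp: free_algebra_def)
    show "x \<otimes>\<^bsub>?A\<^esub> y \<in> carrier ?A" if "x \<in> carrier ?A" "y \<in> carrier ?A" for x y
      using that by (rule free_algebra_mult_closed)
    show "x \<otimes>\<^bsub>?A\<^esub> y \<otimes>\<^bsub>?A\<^esub> z = x \<otimes>\<^bsub>?A\<^esub> (y \<otimes>\<^bsub>?A\<^esub> z)" for x y z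
      using free_algebra_mult_assoc[where f = x and g = y and h = z] by (simp add: free_algebra_def)
    show "\<one>\<^bsub>?A\<^esub> \<otimes>\<^bsub>?A\<^esub> x = x" for x
    proof
      fix w
      have "(\<Sum>k\<le>length w. (if take k w = [] then 1 else 0) * x (drop k w))
          = (\<Sum>k\<le>length w. if k = 0 then x w else 0)"
        by (intro sum.cong) auto
      then show "(\<one>\<^bsub>?A\<^esub> \<otimes>\<^bsub>?A\<^esub> x) w = x w" by (simp add: free_algebra_def)
    qed
    show "x \<otimes>\<^bsub>?A\<^esub> \<one>\<^bsub>?A\<^esub> = x" for x
    proof
      fix w
      have "(\<Sum>k\<le>length w. x (take k w) * (if drop k w = [] then 1 else 0))
          = (\<Sum>k\<le>length w. if k = length w then x w else 0)"
        by (intro sum.cong) auto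
      then show "(x \<otimes>\<^bsub>?A\<^esub> \<one>\<^bsub>?A\<^esub>) w = x w" by (simp add: free_algebra_def)
    qed
  qed
qed (simp_all add: free_algebra_def distrib_left distrib_right sum.distrib)

lemma ring_exterior_algebra: "ring (exterior_algebra B :: ('v list \<Rightarrow> 'f::field) set ring)"
  unfolding exterior_algebra_def
proof (intro ideal.quotient_is_ring ring.genideal_ideal ring_free_algebra)
  have gen: "free_gen b \<in> carrier (free_algebra B)" if "b \<in> B" for b
    using that by (auto simp: free_gen_def free_algebra_def)
  interpret ring "free_algebra B :: ('v list \<Rightarrow> 'f) ring" by (rule ring_free_algebra)
  show "{free_gen i \<otimes>\<^bsub>free_algebra B\<^esub> free_gen j \<oplus>\<^bsub>free_algebra B\<^esub>
           free_gen j \<otimes>\<^bsub>free_algebra B\<^esub> free_gen i | i j. i \<in> B \<and> j \<in> B}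
         \<subseteq> carrier (free_algebra B :: ('v list \<Rightarrow> 'f) ring)"
    by (auto intro!: add.m_closed m_closed gen)
qed

end

theory Submission
  imports Defs
begin

text \<open>The graded statement is a matter of parity. By the sign rule, everything of even degree is central,
  and so is a component of top degree. If \<open>n\<close> is odd, \<open>R\<^sub>n \<noteq> 0\<close> and \<open>R\<^sub>n\<^sub>+\<^sub>1 = 0\<close>, then faithfulness makes \<open>n\<close> the top
  degree, and a noncentral \<open>r\<close> is multiplied by a homogeneous element of even degree that carries its
  lowest odd component into degree \<open>n\<close>: the product is nonzero and has only even components and a top
  one, hence is central (\<open>centrally_essential_if_odd_top\<close>). Conversely, a central element cannot have
  a component of odd degree \<open>i\<close> when \<open>R\<^sub>i\<^sub>+\<^sub>1 \<noteq> 0\<close>, since by faithfulness some element of degree \<open>1\<close>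
  would detect it and anticommute with it (\<open>central_odd_component_zero\<close>). If there is no odd top
  degree, the center is therefore concentrated in even degrees. If moreover \<open>R \<noteq> R\<^sub>0\<close>, faithfulness
  provides an element \<open>r \<noteq> 0\<close> of degree \<open>1\<close>; its products with central elements have only odd
  components, so none of them is central except \<open>0\<close>
  (\<open>odd_top_if_centrally_essential\<close>).

  To apply this to the exterior algebra one has to know that the wedge monomials form a basis; that is
  not evident from generators and relations, because the relations could collapse more than intended.
  The Grassmann algebra on coefficient functions of subsets, with explicit shuffle signs, shows that
  they do not. Sorting words with signs is a surjective ring homomorphism onto it from the free algebra
  (\<open>straighten_mult\<close>, \<open>straighten_surj\<close>), and its kernel is the ideal of relations, because modulo any
  ideal that contains the anticommutators words can be sorted and, as \<open>2\<close> is invertible, words with a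
  repeated letter vanish (\<open>straighten_kernel_subset\<close>). In this model the grading by cardinality visibly satisfies the
  hypotheses of the graded statement, its top degree is the number of generators, and the
  ring is finite over a finite field. The exterior algebra of a three-dimensional space over the field
  with three elements, with its elements renamed to natural numbers, is then the required finite
  example.\<close>

section \<open>Signs, sums and isomorphisms in rings\<close>

lemma (in ring) minus_one_pow:
  "(\<ominus> \<one>) [^] (n::nat) = (if even n then \<one> else \<ominus> \<one>)"
  by (induction n) (auto simp: l_minus r_minus)

lemma (in ring) ring_center_mem_carrier: "c \<in> ring_center R \<Longrightarrow> c \<in> carrier R"
  by (simp add: ring_center_def)

lemma (in ring) additive_subgroup_finsum_closed:
  assumes "additive_subgroup H R" "\<And>i. i \<in> A \<Longrightarrow> f i \<in> H"
  shows "(\<Oplus>i\<in>A. f i) \<in> H"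
proof -
  interpret additive_subgroup H R by (rule assms)
  show ?thesis
    using assms(2)
  proof (induction A rule: infinite_finite_induct)
    case (infinite A)
    then show ?case by (simp add: add.finprod_infinite)
  next
    case (insert a A)
    then show ?case by (subst add.finprod_insert) auto
  qed simp
qed

text \<open>Both the exterior algebra, given by generators and relations, and the finite example
  on natural numbers are studied through isomorphic copies; this carries the conclusions over.\<close>
lemma centrally_essential_ring_iso:
  assumes "ring R" "ring S" "R \<simeq> S" "centrally_essential R"
  shows "centrally_essential S"
proof -
  interpret R: ring R by (rule assms)
  interpret S: ring S by (rule assms)
  obtain h where h: "h \<in> ring_iso R S" using assms(3) by (auto simp: is_ring_iso_def)
  then interpret h: ring_hom_ring R S h
    by (intro ring_hom_ring.intro) (auto simp: ring_iso_def intro!: R.ring_axioms S.ring_axioms ring_hom_ring_axioms.intro)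
  have inj: "inj_on h (carrier R)" and img: "h ` carrier R = carrier S"
    using h by (auto simp: ring_iso_def bij_betw_def)
  have center: "h c \<in> ring_center S \<longleftrightarrow> c \<in> ring_center R" if c: "c \<in> carrier R" for c
  proof -
    have "h c \<otimes>\<^bsub>S\<^esub> h x = h x \<otimes>\<^bsub>S\<^esub> h c \<longleftrightarrow> c \<otimes>\<^bsub>R\<^esub> x = x \<otimes>\<^bsub>R\<^esub> c" if "x \<in> carrier R" for x
      using that c inj by (simp flip: h.hom_mult add: inj_on_eq_iff)
    then show ?thesis
      using c by (auto simp: ring_center_def simp flip: img)
  qed
  show ?thesis
    unfolding S.centrally_essential_iff
  proof
    fix s assume "s \<in> carrier S - {\<zero>\<^bsub>S\<^esub>}"
    then obtain r where r: "r \<in> carrier R - {\<zero>\<^bsub>R\<^esub>}" "s = h r"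
      using img h.hom_zero by (metis Diff_iff image_iff singleton_iff)
    then obtain c where c: "c \<in> ring_center R" "r \<otimes>\<^bsub>R\<^esub> c \<in> ring_center R - {\<zero>\<^bsub>R\<^esub>}"
      using assms(4) R.centrally_essential_iff by blast
    have cc: "c \<in> carrier R" using c R.ring_center_mem_carrier by blast
    have "h (r \<otimes>\<^bsub>R\<^esub> c) \<noteq> h \<zero>\<^bsub>R\<^esub>"
      using inj r c cc by (subst inj_on_eq_iff[OF inj]) auto
    then show "\<exists>c\<in>ring_center S. s \<otimes>\<^bsub>S\<^esub> c \<in> ring_center S - {\<zero>\<^bsub>S\<^esub>}"
      using r c cc center by (intro bexI[of _ "h c"]) (auto simp flip: h.hom_mult)
  qed
qed

section \<open>Homogeneous components\<close>

context graded_ring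
begin

lemma homogeneous_closed: "x \<in> G n \<Longrightarrow> x \<in> carrier R"
  using additive_subgroup.a_Hcarr[OF additive_subgroup_component] .

lemma zero_homogeneous [simp]: "\<zero> \<in> G n"
  using additive_subgroup.zero_closed[OF additive_subgroup_component] .

text \<open>The whole family of homogeneous components of \<open>x\<close>; for \<open>x\<close> outside the carrier its value is
  arbitrary.\<close>
definition component :: "'a \<Rightarrow> nat \<Rightarrow> 'a" where
  "component x = (THE f. (\<forall>n. f n \<in> G n) \<and> finite {n. f n \<noteq> \<zero>} \<and> x = (\<Oplus>n\<in>{n. f n \<noteq> \<zero>}. f n))"

lemma component_properties:
  assumes "x \<in> carrier R"
  shows component_mem: "component x n \<in> G n"
    and finite_component: "finite {n. component x n \<noteq> \<zero>}"
    and finsum_component: "(\<Oplus>n\<in>{n. component x n \<noteq> \<zero>}. component x n) = x"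
  using theI'[OF direct_sum[OF assms]] unfolding component_def by simp_all

lemma component_closed [simp]: "x \<in> carrier R \<Longrightarrow> component x n \<in> carrier R"
  using component_mem homogeneous_closed by blast

text \<open>The index set may be larger than the support of the family, so components of a product can be
  read off from any sum that happens to be homogeneous term by term.\<close>
lemma component_unique:
  assumes "finite A" "\<And>n. f n \<in> G n" "\<And>n. n \<notin> A \<Longrightarrow> f n = \<zero>"
  shows "component (\<Oplus>n\<in>A. f n) = f"
proof -
  have f: "f n \<in> carrier R" for n using assms(2) homogeneous_closed by blast
  let ?D = "{n. f n \<noteq> \<zero>}"
  have sub: "?D \<subseteq> A" using assms(3) by blast
  have eq: "(\<Oplus>n\<in>A. f n) = (\<Oplus>n\<in>?D. f n)"
    by (rule add.finprod_mono_neutral_cong_right) (use assms sub f in auto)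
  have "(\<Oplus>n\<in>A. f n) \<in> carrier R" using f by (intro finsum_closed) auto
  then show ?thesis unfolding component_def
    by (rule the1_equality[OF direct_sum]) (use assms eq sub f finite_subset in auto)
qed

lemma component_zero [simp]: "component \<zero> n = \<zero>"
  using component_unique[of "{}" "\<lambda>_. \<zero>"] by (simp add: fun_eq_iff)

text \<open>Multiplying by a homogeneous factor of degree \<open>m\<close> shifts the decomposition by \<open>m\<close>: distribute the
  factor over the sum of components and use uniqueness.\<close>
lemma component_mult_homogeneous:
  assumes x: "x \<in> carrier R" and y: "y \<in> G m"
  shows component_mult_right: "component (x \<otimes> y) = (\<lambda>n. if m \<le> n then component x (n - m) \<otimes> y else \<zero>)"
    and component_mult_left: "component (y \<otimes> x) = (\<lambda>n. if m \<le> n then y \<otimes> component x (n - m) else \<zero>)"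
proof -
  let ?D = "{n. component x n \<noteq> \<zero>}" and ?E = "(\<lambda>n. n + m) ` {n. component x n \<noteq> \<zero>}"
  note fin = finite_component[OF x]
  have yc: "y \<in> carrier R" using y homogeneous_closed by blast
  \<comment> \<open>in degrees below \<open>m\<close>, truncated subtraction would wrongly return \<open>component x 0\<close>\<close>
  have shift: "n \<in> ?E" if "m \<le> n" "component x (n - m) \<noteq> \<zero>" for n
    using that by (intro image_eqI[of _ _ "n - m"]) auto
  have "x \<otimes> y = (\<Oplus>n\<in>?D. component x n \<otimes> y)"
    using finsum_component[OF x] finsum_ldistr[OF fin yc, of "component x"] x by auto
  also have "\<dots> = (\<Oplus>n\<in>?E. if m \<le> n then component x (n - m) \<otimes> y else \<zero>)"
    by (subst add.finprod_reindex) (use x yc in \<open>auto simp: inj_on_def\<close>)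
  finally show "component (x \<otimes> y) = (\<lambda>n. if m \<le> n then component x (n - m) \<otimes> y else \<zero>)"
  proof (simp only:, intro component_unique)
    show "(if m \<le> n then component x (n - m) \<otimes> y else \<zero>) \<in> G n" for n
      using mult_component[OF component_mem[OF x] y, of "n - m"] by auto
    show "(if m \<le> n then component x (n - m) \<otimes> y else \<zero>) = \<zero>" if "n \<notin> ?E" for n
      using shift[of n] that l_null[OF yc] by metis
  qed (use fin in simp)
  have "y \<otimes> x = (\<Oplus>n\<in>?D. y \<otimes> component x n)"
    using finsum_component[OF x] finsum_rdistr[OF fin yc, of "component x"] x by auto
  also have "\<dots> = (\<Oplus>n\<in>?E. if m \<le> n then y \<otimes> component x (n - m) else \<zero>)"
    by (subst add.finprod_reindex) (use x yc in \<open>auto simp: inj_on_def\<close>)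
  finally show "component (y \<otimes> x) = (\<lambda>n. if m \<le> n then y \<otimes> component x (n - m) else \<zero>)"
  proof (simp only:, intro component_unique)
    show "(if m \<le> n then y \<otimes> component x (n - m) else \<zero>) \<in> G n" for n
      using mult_component[OF y component_mem[OF x], of "n - m"] by auto
    show "(if m \<le> n then y \<otimes> component x (n - m) else \<zero>) = \<zero>" if "n \<notin> ?E" for n
      using shift[of n] that r_null[OF yc] by metis
  qed (use fin in simp)
qed

lemma eq_zero_if_components_zero:
  assumes "x \<in> carrier R" "\<And>n. component x n = \<zero>"
  shows "x = \<zero>"
  using finsum_component[OF assms(1)] assms(2) by simp

lemma central_if_components_central:
  assumes "x \<in> carrier R" "\<And>n. component x n \<in> ring_center R"
  shows "x \<in> ring_center R"
  using additive_subgroup_finsum_closed[OF additive_subgroup_center, of _ "component x"] assms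
    finsum_component[OF assms(1)] by metis

lemma central_if_commutes_homogeneous:
  assumes "c \<in> carrier R" "\<And>n y. y \<in> G n \<Longrightarrow> c \<otimes> y = y \<otimes> c"
  shows "c \<in> ring_center R"
  unfolding ring_center_def
proof (intro CollectI conjI ballI assms(1))
  fix x assume x: "x \<in> carrier R"
  note D = finite_component[OF x]
  have "c \<otimes> x = (\<Oplus>n\<in>{n. component x n \<noteq> \<zero>}. c \<otimes> component x n)"
    using finsum_rdistr[OF D assms(1), of "component x"] finsum_component[OF x] x by auto
  also have "\<dots> = (\<Oplus>n\<in>{n. component x n \<noteq> \<zero>}. component x n \<otimes> c)"
    using assms component_mem[OF x] x by (intro add.finprod_cong') auto
  also have "\<dots> = x \<otimes> c"
    using finsum_ldistr[OF D assms(1), of "component x"] finsum_component[OF x] x by auto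
  finally show "c \<otimes> x = x \<otimes> c" .
qed

end

section \<open>Central essentiality of generalized anticommutative rings\<close>

locale faithful_anticommutative_ring = graded_ring +
  assumes anticommutative: "generalized_anticommutative R G"
    and faithful: "homogeneously_faithful R G"
    and no_2_torsion: "no_additive_2_torsion R"
begin

text \<open>The sign rule as it is used: elements of degrees \<open>m\<close> and \<open>n\<close> anticommute if both degrees are odd,
  and commute otherwise.\<close>
lemma mult_commute_graded:
  assumes "x \<in> G m" "y \<in> G n"
  shows "y \<otimes> x = (if even (m * n) then x \<otimes> y else \<ominus> (x \<otimes> y))"
proof -
  have "x \<in> carrier R" "y \<in> carrier R" using assms homogeneous_closed by blast+
  moreover have "y \<otimes> x = (\<ominus> \<one>) [^] (m * n) \<otimes> (x \<otimes> y)"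
    using anticommutative assms unfolding generalized_anticommutative_def by blast
  ultimately show ?thesis by (simp add: minus_one_pow l_minus)
qed

lemma eq_zero_if_double_zero: "x \<in> carrier R \<Longrightarrow> x \<oplus> x = \<zero> \<Longrightarrow> x = \<zero>"
  using no_2_torsion unfolding no_additive_2_torsion_def by blast

lemma faithful_lower: "G (m + n) \<noteq> {\<zero>} \<Longrightarrow> G m \<noteq> {\<zero>}"
  using faithful unfolding homogeneously_faithful_def by blast

lemma faithful_witness:
  assumes "G (m + n) \<noteq> {\<zero>}" "x \<in> G m" "x \<noteq> \<zero>"
  obtains y where "y \<in> G n" "x \<otimes> y \<noteq> \<zero>"
proof -
  have "(\<lambda>y. x \<otimes> y) ` G n \<noteq> {\<zero>}"
    using faithful assms unfolding homogeneously_faithful_def by blast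
  moreover have "G n \<noteq> {}" using zero_homogeneous by blast
  ultimately show ?thesis using that by (metis image_is_empty image_subsetI singletonI subset_singletonD singletonD)
qed

lemma nonzero_component_mono:
  assumes "G n \<noteq> {\<zero>}" "m \<le> n"
  shows "G m \<noteq> {\<zero>}"
  using faithful_lower[of m "n - m"] assms by simp

text \<open>The sign \<open>(-1)^(m * n)\<close> is trivial as soon as one of the two degrees is even.\<close>
lemma even_component_central:
  assumes "even n" "x \<in> G n"
  shows "x \<in> ring_center R"
proof (rule central_if_commutes_homogeneous)
  show "x \<in> carrier R" using assms homogeneous_closed by blast
  show "x \<otimes> y = y \<otimes> x" if "y \<in> G m" for m y
    using mult_commute_graded[OF assms(2) that] assms(1) by simp
qed

text \<open>In the top degree, products with elements of positive degree vanish on both sides, and products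
  with elements of degree \<open>0\<close> commute by the sign rule.\<close>
lemma top_component_central:
  assumes top: "G (n + 1) = {\<zero>}" and x: "x \<in> G n"
  shows "x \<in> ring_center R"
proof (rule central_if_commutes_homogeneous)
  show "x \<in> carrier R" using x homogeneous_closed by blast
  show "x \<otimes> y = y \<otimes> x" if y: "y \<in> G m" for m y
  proof (cases "m = 0")
    case True
    then show ?thesis using mult_commute_graded[OF x y] by simp
  next
    case False
    then have "G (n + m) = {\<zero>}" using nonzero_component_mono[of "n + m" "n + 1"] top by fastforce
    then have "x \<otimes> y = \<zero>" "y \<otimes> x = \<zero>"
      using mult_component[OF x y] mult_component[OF y x] by (auto simp: add.commute)
    then show ?thesis by simp
  qed
qed

text \<open>Here the absence of \<open>2\<close>-torsion decides. A component \<open>z\<^sub>i \<noteq> 0\<close> of odd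
  degree would have \<open>z\<^sub>i y \<noteq> 0\<close> for some \<open>y\<close> of degree \<open>1\<close>; comparing components in \<open>z y = y z\<close>
  gives \<open>z\<^sub>i y = y z\<^sub>i = - z\<^sub>i y\<close>, which is impossible.\<close>
lemma central_odd_component_zero:
  assumes nz: "G (i + 1) \<noteq> {\<zero>}" and "odd i" and z: "z \<in> ring_center R"
  shows "component z i = \<zero>"
proof (rule ccontr)
  have zc: "z \<in> carrier R" using z ring_center_mem_carrier by blast
  assume "component z i \<noteq> \<zero>"
  then obtain y where y: "y \<in> G 1" "component z i \<otimes> y \<noteq> \<zero>"
    using faithful_witness[OF nz component_mem[OF zc]] by blast
  have yc: "y \<in> carrier R" using y homogeneous_closed by blast
  have "component (z \<otimes> y) (i + 1) = component (y \<otimes> z) (i + 1)"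
    using z yc by (simp add: ring_center_def)
  then have "component z i \<otimes> y = y \<otimes> component z i"
    by (simp add: component_mult_homogeneous[OF zc y(1)])
  also have "\<dots> = \<ominus> (component z i \<otimes> y)"
    using mult_commute_graded[OF component_mem[OF zc] y(1)] \<open>odd i\<close> by simp
  finally have "component z i \<otimes> y \<oplus> component z i \<otimes> y = \<zero>"
    using zc yc by (metis component_closed m_closed r_neg)
  then show False
    using eq_zero_if_double_zero[OF m_closed[OF component_closed[OF zc] yc]] y(2) by blast
qed

text \<open>If \<open>r\<close> is not already central, let \<open>i\<close> be the least odd degree in which it has a nonzero component.
  Multiplying by a suitable \<open>y\<close> of the even degree \<open>n - i\<close> lifts this component to a nonzero element of
  the top degree \<open>n\<close> and pushes all higher odd components beyond the top, so \<open>r y\<close> has only even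
  components and a top one. All of these are central, and \<open>y\<close> is central because its degree is even.\<close>
lemma centrally_essential_if_odd_top:
  assumes n: "odd n" "G n \<noteq> {\<zero>}" and top: "G (n + 1) = {\<zero>}"
  shows "centrally_essential R"
  unfolding centrally_essential_iff
proof
  fix r assume "r \<in> carrier R - {\<zero>}"
  then have r: "r \<in> carrier R" "r \<noteq> \<zero>" by blast+
  have above: "component x k = \<zero>" if "k > n" "x \<in> carrier R" for k x
  proof -
    have "G k = {\<zero>}" using nonzero_component_mono[of k "n + 1"] top that(1) by (metis Suc_eq_plus1 Suc_leI)
    then show ?thesis using component_mem[OF that(2), of k] by blast
  qed
  have central: "x \<in> ring_center R"
    if x: "x \<in> carrier R" and odd_below: "\<And>k. odd k \<Longrightarrow> k < n \<Longrightarrow> component x k = \<zero>" for x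
  proof (rule central_if_components_central[OF x])
    fix k
    consider "even k" | "k = n" | "k > n" | "odd k" "k < n" by linarith
    then show "component x k \<in> ring_center R"
      by cases (use even_component_central top_component_central[OF top] component_mem[OF x]
          above[OF _ x] odd_below additive_subgroup.zero_closed[OF additive_subgroup_center] in auto)
  qed
  show "\<exists>c\<in>ring_center R. r \<otimes> c \<in> ring_center R - {\<zero>}"
  proof (cases "\<exists>i. odd i \<and> component r i \<noteq> \<zero>")
    case False
    then have "r \<in> ring_center R" using central r by blast
    then show ?thesis using r by (intro bexI[of _ \<one>]) (auto simp: ring_center_def)
  next
    case True
    define i where "i = (LEAST i. odd i \<and> component r i \<noteq> \<zero>)"
    have i: "odd i" "component r i \<noteq> \<zero>" using LeastI_ex[OF True] unfolding i_def by auto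
    have least: "component r k = \<zero>" if "odd k" "k < i" for k
      using not_less_Least that unfolding i_def by blast
    have "i \<le> n" using i above r by (meson not_le)
    then obtain y where y: "y \<in> G (n - i)" "component r i \<otimes> y \<noteq> \<zero>"
      using faithful_witness[of i "n - i" "component r i"] n i component_mem[OF r(1)] by auto
    have yc: "y \<in> carrier R" using y homogeneous_closed by blast
    have "even (n - i)" using n i by simp
    then have "y \<in> ring_center R" using even_component_central y by blast
    moreover have "r \<otimes> y \<in> ring_center R"
    proof (rule central)
      show "component (r \<otimes> y) k = \<zero>" if "odd k" "k < n" for k
      proof (cases "n - i \<le> k")
        case True
        then have "odd (k - (n - i))" "k - (n - i) < i"
          using \<open>i \<le> n\<close> \<open>even (n - i)\<close> that by (simp, linarith)
        then show ?thesis using least yc by (simp add: component_mult_right[OF r(1) y(1)])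
      qed (simp add: component_mult_right[OF r(1) y(1)])
    qed (use r yc in simp)
    moreover have "component (r \<otimes> y) n \<noteq> \<zero>"
      using y \<open>i \<le> n\<close> by (simp add: component_mult_right[OF r(1) y(1)])
    then have "r \<otimes> y \<noteq> \<zero>" by auto
    ultimately show ?thesis by blast
  qed
qed

text \<open>Otherwise every nonzero odd degree is followed by a nonzero degree, so the center lies in the
  even part. A nonzero \<open>r\<close> of degree \<open>1\<close> then has only odd components in every product \<open>r c\<close> with
  central \<open>c\<close>, and \<open>r c\<close> can be central only if it is \<open>0\<close>.\<close>
lemma odd_top_if_centrally_essential:
  assumes ce: "centrally_essential R" and nontriv: "carrier R \<noteq> G 0"
  shows "\<exists>n. odd n \<and> G n \<noteq> {\<zero>} \<and> G (n + 1) = {\<zero>}"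
proof (rule ccontr)
  assume no: "\<not> ?thesis"
  then have no_top: "G (i + 1) \<noteq> {\<zero>}" if "odd i" "G i \<noteq> {\<zero>}" for i
    using that no by metis
  have central_even: "component z i = \<zero>" if "odd i" "z \<in> ring_center R" for z i
  proof (cases "G i = {\<zero>}")
    case True
    then show ?thesis using component_mem[of z i] ring_center_mem_carrier that by auto
  next
    case False
    then show ?thesis using central_odd_component_zero no_top that by blast
  qed
  obtain x where x: "x \<in> carrier R" "x \<notin> G 0"
    using nontriv homogeneous_closed by blast
  have "\<exists>k>0. component x k \<noteq> \<zero>"
  proof (rule ccontr)
    assume "\<not> ?thesis"
    then have "n = 0" if "component x n \<noteq> \<zero>" for n using that by (metis neq0_conv)
    then have "component x n \<in> G 0" if "n \<in> {n. component x n \<noteq> \<zero>}" for n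
      using component_mem[OF x(1), of n] that by blast
    then have "(\<Oplus>n\<in>{n. component x n \<noteq> \<zero>}. component x n) \<in> G 0"
      by (rule additive_subgroup_finsum_closed[OF additive_subgroup_component])
    then show False using x(2) finsum_component[OF x(1)] by metis
  qed
  then obtain k where k: "k > 0" "component x k \<noteq> \<zero>" by blast
  have "G k \<noteq> {\<zero>}" using component_mem[OF x(1), of k] k(2) by blast
  then have "G 1 \<noteq> {\<zero>}" using nonzero_component_mono[of k 1] k by simp
  then obtain r where r: "r \<in> G 1" "r \<noteq> \<zero>" using zero_homogeneous[of 1] by blast
  have rc: "r \<in> carrier R" using r homogeneous_closed by blast
  obtain c where c: "c \<in> ring_center R" "r \<otimes> c \<in> ring_center R" "r \<otimes> c \<noteq> \<zero>"
    using ce r rc unfolding centrally_essential_iff by blast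
  have cc: "c \<in> carrier R" using c ring_center_mem_carrier by blast
  have "component (r \<otimes> c) i = \<zero>" for i
  proof (cases "odd i")
    case True
    then show ?thesis using central_even c by blast
  next
    case False
    then have "1 \<le> i \<Longrightarrow> odd (i - 1)" by simp
    then show ?thesis
      using central_even c rc by (auto simp: component_mult_left[OF cc r(1)])
  qed
  then show False using eq_zero_if_components_zero c rc cc by simp
qed

theorem centrally_essential_iff_odd_top:
  "centrally_essential R \<longleftrightarrow>
     carrier R = G 0 \<or> (\<exists>n. odd n \<and> G n \<noteq> {\<zero>} \<and> G (n + 1) = {\<zero>})"
proof -
  have "centrally_essential R" if "carrier R = G 0"
  proof -
    have "r \<in> ring_center R" if "r \<in> carrier R" for r
      using that even_component_central[of 0] \<open>carrier R = G 0\<close> by simp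
    then show ?thesis
      unfolding centrally_essential_iff by (intro ballI bexI[of _ \<one>]) auto
  qed
  then show ?thesis
    using centrally_essential_if_odd_top odd_top_if_centrally_essential by metis
qed

lemma not_cring_if_degree_2:
  assumes "G 2 \<noteq> {\<zero>}"
  shows "\<not> cring R"
proof
  assume "cring R"
  have "G (1 + 1) \<noteq> {\<zero>}" using assms by (simp add: numeral_2_eq_2)
  then obtain x where x: "x \<in> G 1" "x \<noteq> \<zero>"
    using nonzero_component_mono[of 2 1] assms zero_homogeneous by fastforce
  obtain y where y: "y \<in> G 1" "x \<otimes> y \<noteq> \<zero>"
    using faithful_witness[OF \<open>G (1 + 1) \<noteq> {\<zero>}\<close> x] by blast
  have carr: "x \<in> carrier R" "y \<in> carrier R" using x y homogeneous_closed by blast+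
  have "\<ominus> (x \<otimes> y) = x \<otimes> y"
    using mult_commute_graded[OF x(1) y(1)] cring.cring_simprules(14)[OF \<open>cring R\<close>] carr by simp
  then have "x \<otimes> y \<oplus> x \<otimes> y = \<zero>" using carr by (metis m_closed r_neg)
  then show False using eq_zero_if_double_zero[OF m_closed[OF carr]] y(2) by blast
qed

end

section \<open>Signs of words\<close>

text \<open>For disjoint finite sets, the sign of the shuffle that sorts the concatenation of the sorted words of
  \<open>S\<close> and of \<open>T\<close>: one factor \<open>-1\<close> for every pair of letters that stands in the wrong order. The numbering \<open>r\<close> supplies an order
  on generators of a type that need not be ordered.\<close>
definition crossing_sign :: "('v \<Rightarrow> nat) \<Rightarrow> 'v set \<Rightarrow> 'v set \<Rightarrow> 'f::field" where
  "crossing_sign r S T = (\<Prod>a\<in>S. \<Prod>b\<in>T. if r b < r a then - 1 else 1)"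

lemma crossing_sign_square: "crossing_sign r S T * crossing_sign r S T = (1 :: 'f::field)"
  unfolding crossing_sign_def by (auto simp flip: prod.distrib intro!: prod.neutral)

lemma crossing_sign_nonzero: "crossing_sign r S T \<noteq> (0 :: 'f::field)"
  using crossing_sign_square[of r S T, where 'f = 'f] by auto

lemma crossing_sign_empty [simp]:
  "crossing_sign r {} T = (1 :: 'f::field)" "crossing_sign r S {} = (1 :: 'f)"
  by (simp_all add: crossing_sign_def)

lemma crossing_sign_Un_left:
  assumes "finite S" "finite S'" "S \<inter> S' = {}"
  shows "crossing_sign r (S \<union> S') T = (crossing_sign r S T * crossing_sign r S' T :: 'f::field)"
  using assms by (simp add: crossing_sign_def prod.union_disjoint)

lemma crossing_sign_Un_right:
  assumes "finite T" "finite T'" "T \<inter> T' = {}"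
  shows "crossing_sign r S (T \<union> T') = (crossing_sign r S T * crossing_sign r S T' :: 'f::field)"
  using assms by (simp add: crossing_sign_def prod.union_disjoint prod.distrib)

text \<open>Each of the \<open>card S * card T\<close> pairs is inverted in exactly one of the two concatenations. This is
  the source of the graded sign rule.\<close>
lemma crossing_sign_swap:
  assumes "inj_on r (S \<union> T)" "S \<inter> T = {}"
  shows "crossing_sign r T S = ((- 1) ^ (card S * card T) * crossing_sign r S T :: 'f::field)"
proof -
  have "crossing_sign r T S * crossing_sign r S T
      = (\<Prod>a\<in>S. \<Prod>b\<in>T. (if r a < r b then - 1 else 1) * (if r b < r a then - 1 else (1::'f)))"
    unfolding crossing_sign_def by (subst prod.swap) (simp add: prod.distrib)
  also have "\<dots> = (\<Prod>a\<in>S. \<Prod>b\<in>T. - 1)"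
  proof (intro prod.cong refl)
    fix a b assume "a \<in> S" "b \<in> T"
    then have "r a \<noteq> r b" using assms by (auto simp: inj_on_def)
    then show "(if r a < r b then - 1 else 1) * (if r b < r a then - 1 else 1) = (- 1 :: 'f)" by auto
  qed
  also have "\<dots> = (- 1) ^ (card S * card T)"
    by (simp add: mult.commute flip: power_mult)
  finally have "(crossing_sign r T S * crossing_sign r S T) * crossing_sign r S T
      = (- 1) ^ (card S * card T) * (crossing_sign r S T :: 'f)" by simp
  then show ?thesis by (simp add: mult.assoc crossing_sign_square)
qed

text \<open>For a word without repetitions, the sign of the permutation that sorts it, found by counting for
  each letter the smaller letters that follow it.\<close>
primrec word_sign :: "('v \<Rightarrow> nat) \<Rightarrow> 'v list \<Rightarrow> 'f::field" where
  "word_sign r [] = 1"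
| "word_sign r (a # w) = crossing_sign r {a} (set w) * word_sign r w"

lemma word_sign_square: "word_sign r w * word_sign r w = (1 :: 'f::field)"
proof (induction w)
  case (Cons a w)
  have "word_sign r (a # w) * word_sign r (a # w)
      = (crossing_sign r {a} (set w) * crossing_sign r {a} (set w)) * (word_sign r w * word_sign r w :: 'f)"
    by (simp add: mult_ac)
  then show ?case by (simp only: Cons crossing_sign_square) simp
qed simp

lemma word_sign_append:
  assumes "distinct (u @ v)"
  shows "word_sign r (u @ v) = (word_sign r u * word_sign r v * crossing_sign r (set u) (set v) :: 'f::field)"
  using assms
proof (induction u)
  case (Cons a u)
  have "crossing_sign r (set (a # u)) (set v)
      = (crossing_sign r {a} (set v) * crossing_sign r (set u) (set v) :: 'f)"
    using Cons.prems crossing_sign_Un_left[of "{a}" "set u" r "set v"] by simp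
  moreover have "crossing_sign r {a} (set (u @ v))
      = (crossing_sign r {a} (set u) * crossing_sign r {a} (set v) :: 'f)"
    using Cons.prems by (simp add: crossing_sign_Un_right)
  ultimately show ?case using Cons by (simp add: mult_ac)
qed simp

lemma word_sign_move_to_front:
  assumes "distinct (u @ a # v)" "inj_on r (set (u @ a # v))"
  shows "word_sign r (u @ a # v) = ((- 1) ^ length u * word_sign r (a # u @ v) :: 'f::field)"
proof -
  have "crossing_sign r (set u) (set (a # v))
      = (crossing_sign r (set u) {a} * crossing_sign r (set u) (set v) :: 'f)"
    using assms(1) crossing_sign_Un_right[of "{a}" "set v" r "set u"] by simp
  moreover have "crossing_sign r {a} (set (u @ v))
      = (crossing_sign r {a} (set u) * crossing_sign r {a} (set v) :: 'f)"
    using assms(1) by (simp add: crossing_sign_Un_right)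
  moreover have "crossing_sign r (set u) {a} = ((- 1) ^ length u * crossing_sign r {a} (set u) :: 'f)"
    using crossing_sign_swap[of r "{a}" "set u"] assms
    by (simp add: distinct_card inj_on_def)
  moreover have "distinct (u @ v)" using assms(1) by simp
  ultimately show ?thesis
    using word_sign_append[OF assms(1), where 'f = 'f and r = r] word_sign_append[of u v r, where 'f = 'f]
    by (simp add: mult_ac)
qed

section \<open>The Grassmann algebra as a quotient of the free algebra\<close>

text \<open>A concrete model of the exterior algebra: \<open>x S\<close> is the coefficient at the wedge product of the
  elements of \<open>S\<close> in the order of their numbers, and the product of two such monomials is \<open>0\<close> unless their index
  sets are disjoint. For an infinite index set \<open>U\<close> the sum over \<open>Pow U\<close> is \<open>0\<close> by convention.\<close>
definition grassmann :: "('v \<Rightarrow> nat) \<Rightarrow> 'v set \<Rightarrow> ('v set \<Rightarrow> 'f::field) ring" where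
  "grassmann r B =
     \<lparr>carrier = {x. \<forall>S. x S \<noteq> 0 \<longrightarrow> S \<subseteq> B},
      monoid.mult = (\<lambda>x y U. \<Sum>S\<in>Pow U. crossing_sign r S (U - S) * x S * y (U - S)),
      one = (\<lambda>S. if S = {} then 1 else 0),
      ring.zero = (\<lambda>S. 0),
      ring.add = (\<lambda>x y S. x S + y S)\<rparr>"

definition arrangements :: "'v set \<Rightarrow> 'v list set" where
  "arrangements S = {w. distinct w \<and> set w = S}"

text \<open>Rewrites a noncommutative polynomial in terms of sorted monomials: a word without repetitions
  contributes its coefficient, with the sign of the word, to the set of its letters, and a word with
  a repeated letter contributes nothing.\<close>
definition straighten :: "('v \<Rightarrow> nat) \<Rightarrow> ('v list \<Rightarrow> 'f::field) \<Rightarrow> 'v set \<Rightarrow> 'f" where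
  "straighten r f S = (\<Sum>w\<in>arrangements S. word_sign r w * f w)"

definition some_arrangement :: "'v set \<Rightarrow> 'v list" where
  "some_arrangement S = (SOME w. w \<in> arrangements S)"

lemma finite_arrangements [simp]: "finite (arrangements S)"
proof (cases "finite S")
  case True
  have "arrangements S \<subseteq> {w. set w \<subseteq> S \<and> length w = card S}"
    by (auto simp: arrangements_def distinct_card)
  then show ?thesis using finite_lists_length_eq[OF True] finite_subset by blast
next
  case False
  then have "arrangements S = {}" by (auto simp: arrangements_def)
  then show ?thesis by simp
qed

lemma some_arrangement_mem: "finite S \<Longrightarrow> some_arrangement S \<in> arrangements S"
  unfolding some_arrangement_def
  by (rule someI_ex) (use finite_distinct_list in \<open>auto simp: arrangements_def\<close>)

lemma set_some_arrangement [simp]: "finite S \<Longrightarrow> set (some_arrangement S) = S"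
  using some_arrangement_mem by (auto simp: arrangements_def)

lemma straighten_closed:
  assumes "f \<in> carrier (free_algebra B)"
  shows "straighten r f \<in> carrier (grassmann r B)"
proof -
  have "S \<subseteq> B" if nz: "straighten r f S \<noteq> 0" for S
  proof -
    obtain w where "w \<in> arrangements S" "f w \<noteq> 0"
      using nz unfolding straighten_def
      by (metis (no_types, lifting) mult_zero_right sum.not_neutral_contains_not_neutral)
    then show ?thesis using assms by (auto simp: arrangements_def free_algebra_def)
  qed
  then show ?thesis by (simp add: grassmann_def)
qed

text \<open>Cutting an arrangement of \<open>U\<close> into two words is the same as choosing a subset \<open>S\<close> of \<open>U\<close> and
  arrangements of \<open>S\<close> and of \<open>U - S\<close>; the signs agree by the formula for the sign of a concatenation.\<close>
lemma straighten_mult: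
  fixes f g :: "'v list \<Rightarrow> 'f::field"
  shows "straighten r (f \<otimes>\<^bsub>free_algebra B\<^esub> g) = straighten r f \<otimes>\<^bsub>grassmann r B\<^esub> straighten r g"
proof
  fix U
  show "straighten r (f \<otimes>\<^bsub>free_algebra B\<^esub> g) U = (straighten r f \<otimes>\<^bsub>grassmann r B\<^esub> straighten r g) U"
  proof (cases "finite U")
    case False
    then have "arrangements U = {}" "infinite (Pow U)" by (auto simp: arrangements_def)
    then show ?thesis by (simp add: straighten_def grassmann_def)
  next
    case True
    let ?t = "\<lambda>w k. word_sign r w * (f (take k w) * g (drop k w))"
    have "straighten r (f \<otimes>\<^bsub>free_algebra B\<^esub> g) U = (\<Sum>w\<in>arrangements U. \<Sum>k\<le>length w. ?t w k)"
      by (simp add: straighten_def free_algebra_def sum_distrib_left)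
    also have "\<dots> = (\<Sum>(w, k)\<in>(SIGMA w:arrangements U. {..length w}). ?t w k)"
      by (subst sum.Sigma) auto
    also have "\<dots> = (\<Sum>(S, u, v)\<in>(SIGMA S:Pow U. arrangements S \<times> arrangements (U - S)).
        crossing_sign r S (U - S) * (word_sign r u * f u) * (word_sign r v * g v))"
    proof (rule sum.reindex_bij_witness[where i = "\<lambda>(S, u, v). (u @ v, length u)"
          and j = "\<lambda>(w, k). (set (take k w), take k w, drop k w)"], goal_cases)
      case (1 p)
      then show ?case by auto
    next
      case (2 p)
      then obtain w k where p: "p = (w, k)" "w \<in> arrangements U" "k \<le> length w" by auto
      have "distinct (take k w @ drop k w)" "set (take k w @ drop k w) = U"
        using p by (simp_all add: arrangements_def)
      then have "distinct (take k w)" "distinct (drop k w)"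
        "set (take k w) \<inter> set (drop k w) = {}" "set (take k w) \<union> set (drop k w) = U"
        by (simp_all only: distinct_append set_append)
      then show ?case unfolding p(1) by (auto simp: arrangements_def)
    next
      case (3 q)
      then show ?case by (auto simp: arrangements_def)
    next
      case (4 q)
      then show ?case by (auto simp: arrangements_def)
    next
      case (5 p)
      then obtain w k where p: "p = (w, k)" "w \<in> arrangements U" "k \<le> length w" by auto
      have d: "distinct (take k w @ drop k w)" and s: "set (take k w @ drop k w) = U"
        using p by (simp_all add: arrangements_def)
      then have "U - set (take k w) = set (drop k w)" by (simp only: distinct_append set_append) blast
      then show ?case using word_sign_append[OF d, of r, where 'f = 'f] unfolding p(1) by (simp add: mult_ac)
    qed
    also have "\<dots> = (\<Sum>S\<in>Pow U. \<Sum>(u, v)\<in>arrangements S \<times> arrangements (U - S).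
        crossing_sign r S (U - S) * (word_sign r u * f u) * (word_sign r v * g v))"
      using True by (subst sum.Sigma) auto
    also have "\<dots> = (straighten r f \<otimes>\<^bsub>grassmann r B\<^esub> straighten r g) U"
      by (simp add: grassmann_def straighten_def sum.cartesian_product[symmetric] sum_distrib_left
          sum_distrib_right mult_ac)
    finally show ?thesis .
  qed
qed

lemma straighten_ring_hom:
  "(straighten r :: ('v list \<Rightarrow> 'f::field) \<Rightarrow> _) \<in> ring_hom (free_algebra B) (grassmann r B)"
proof (rule ring_hom_memI)
  show "straighten r \<one>\<^bsub>free_algebra B\<^esub> = (\<one>\<^bsub>grassmann r B\<^esub> :: 'v set \<Rightarrow> 'f)"
  proof
    fix S :: "'v set"
    have "(\<Sum>w\<in>arrangements S. word_sign r w * (if w = [] then 1 else 0))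
        = (\<Sum>w\<in>arrangements S. if w = [] then 1 else (0::'f))"
      by (intro sum.cong) auto
    also have "\<dots> = (if S = {} then 1 else 0)"
      by (simp add: sum.delta) (simp add: arrangements_def)
    finally show "straighten r \<one>\<^bsub>free_algebra B\<^esub> S = (\<one>\<^bsub>grassmann r B\<^esub> S :: 'f)"
      by (simp add: straighten_def free_algebra_def grassmann_def)
  qed
  show "straighten r (x \<oplus>\<^bsub>free_algebra B\<^esub> y) = straighten r x \<oplus>\<^bsub>grassmann r B\<^esub> straighten r y" for x y
    by (simp add: straighten_def free_algebra_def grassmann_def distrib_left sum.distrib fun_eq_iff)
qed (simp_all add: straighten_closed straighten_mult)

text \<open>Putting the coefficient at \<open>S\<close>, multiplied by the sign of one chosen arrangement of \<open>S\<close>, on that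
  arrangement gives a preimage, because signs square to \<open>1\<close>.\<close>
lemma straighten_surj:
  assumes "finite B"
  shows "straighten r ` carrier (free_algebra B) = carrier (grassmann r B :: ('v set \<Rightarrow> 'f::field) ring)"
proof (intro equalityI subsetI)
  fix x :: "'v set \<Rightarrow> 'f" assume "x \<in> carrier (grassmann r B)"
  then have supp: "S \<subseteq> B" if "x S \<noteq> 0" for S using that by (simp add: grassmann_def)
  define f where "f w = (if w = some_arrangement (set w) then word_sign r w * x (set w) else 0)" for w
  have "w \<in> some_arrangement ` Pow B \<and> w \<in> lists B" if "f w \<noteq> 0" for w
    using that supp[of "set w"] by (auto simp: f_def split: if_splits)
  then have "{w. f w \<noteq> 0} \<subseteq> some_arrangement ` Pow B" "{w. f w \<noteq> 0} \<subseteq> lists B" by blast+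
  then have "f \<in> carrier (free_algebra B)"
    using assms finite_subset by (fastforce simp: free_algebra_def)
  moreover have "straighten r f = x"
  proof
    fix S
    show "straighten r f S = x S"
    proof (cases "finite S")
      case True
      have "straighten r f S
          = (\<Sum>w\<in>arrangements S. if w = some_arrangement S then word_sign r w * word_sign r w * x S else 0)"
        unfolding straighten_def f_def by (intro sum.cong) (auto simp: arrangements_def mult.assoc)
      then show ?thesis
        using some_arrangement_mem[OF True] by (simp add: word_sign_square)
    next
      case False
      then have "arrangements S = {}" "x S = 0"
        using supp[of S] assms finite_subset[of S B] by (auto simp: arrangements_def)
      then show ?thesis by (simp add: straighten_def)
    qed
  qed
  ultimately show "x \<in> straighten r ` carrier (free_algebra B)" by blast
qed (auto simp: straighten_closed)

text \<open>The ring laws need no computation with signs: the model is a homomorphic image of the free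
  algebra.\<close>
lemma ring_grassmann:
  assumes "finite B"
  shows "ring (grassmann r B :: ('v set \<Rightarrow> 'f::field) ring)"
proof -
  have "straighten r \<zero>\<^bsub>free_algebra B\<^esub> = (\<zero>\<^bsub>grassmann r B\<^esub> :: 'v set \<Rightarrow> 'f)"
    by (simp add: straighten_def free_algebra_def grassmann_def fun_eq_iff)
  with ring.ring_hom_imp_img_ring[OF ring_free_algebra straighten_ring_hom[where 'f = 'f and r = r and B = B]]
  show ?thesis
    by (simp add: straighten_surj[OF assms])
qed

section \<open>Sorting words modulo the anticommutators\<close>

definition monomial :: "'f::field \<Rightarrow> 'v list \<Rightarrow> 'v list \<Rightarrow> 'f" where
  "monomial c w = (\<lambda>v. if v = w then c else 0)"

lemma monomial_mult:
  fixes c d :: "'f::field"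
  shows "monomial c u \<otimes>\<^bsub>free_algebra B\<^esub> monomial d v = monomial (c * d) (u @ v)"
proof
  fix w
  have "(\<Sum>k\<le>length w. monomial c u (take k w) * monomial d v (drop k w))
      = (\<Sum>k\<le>length w. if k = length u then monomial (c * d) (u @ v) w else 0)"
  proof (intro sum.cong refl)
    fix k assume "k \<in> {..length w}"
    then have "take k w = u \<and> drop k w = v \<longleftrightarrow> k = length u \<and> w = u @ v"
      by (metis append_eq_conv_conj append_take_drop_id atMost_iff length_take min.absorb2)
    moreover have "monomial c u (take k w) * monomial d v (drop k w)
        = (if take k w = u \<and> drop k w = v then c * d else 0)"
      by (simp add: monomial_def)
    ultimately show "monomial c u (take k w) * monomial d v (drop k w)
        = (if k = length u then monomial (c * d) (u @ v) w else 0)"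
      by (simp add: monomial_def)
  qed
  also have "\<dots> = monomial (c * d) (u @ v) w"
    by (auto simp: monomial_def)
  finally show "(monomial c u \<otimes>\<^bsub>free_algebra B\<^esub> monomial d v) w = monomial (c * d) (u @ v) w"
    by (simp add: free_algebra_def)
qed

lemma free_gen_eq_monomial: "free_gen b = monomial 1 [b]"
  by (simp add: free_gen_def monomial_def)

lemma monomial_closed: "w \<in> lists B \<Longrightarrow> monomial c w \<in> carrier (free_algebra B)"
  by (auto simp: monomial_def free_algebra_def intro: finite_subset[of _ "{w}"])

definition anticommutators :: "'v set \<Rightarrow> ('v list \<Rightarrow> 'f::field) set" where
  "anticommutators B =
     {free_gen i \<otimes>\<^bsub>free_algebra B\<^esub> free_gen j \<oplus>\<^bsub>free_algebra B\<^esub>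
        free_gen j \<otimes>\<^bsub>free_algebra B\<^esub> free_gen i | i j. i \<in> B \<and> j \<in> B}"

lemma anticommutators_eq:
  "anticommutators B = {\<lambda>w. monomial (1::'f::field) [i, j] w + monomial 1 [j, i] w | i j. i \<in> B \<and> j \<in> B}"
  unfolding anticommutators_def free_gen_eq_monomial monomial_mult by (simp add: free_algebra_def)

lemma anticommutators_closed: "anticommutators B \<subseteq> carrier (free_algebra B)"
proof -
  interpret ring "free_algebra B :: ('a list \<Rightarrow> 'b) ring" by (rule ring_free_algebra)
  show ?thesis
    by (auto simp: anticommutators_def free_gen_eq_monomial monomial_closed intro!: a_closed m_closed)
qed

lemma exterior_algebra_eq:
  "exterior_algebra B = free_algebra B Quot (Idl\<^bsub>free_algebra B\<^esub> anticommutators B)"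
  by (simp add: exterior_algebra_def anticommutators_def)

text \<open>An arbitrary ideal that contains the defining relations. Computing modulo such an ideal, words can
  be sorted at the cost of a sign.\<close>
locale ideal_with_anticommutators = ideal I "free_algebra B"
  for I :: "('v list \<Rightarrow> 'f::field) set" and B :: "'v set" +
  assumes anticommutators: "anticommutators B \<subseteq> I"
    and two_nonzero: "(2 :: 'f::field) \<noteq> 0"
begin

lemma add_mem: "f \<in> I \<Longrightarrow> g \<in> I \<Longrightarrow> (\<lambda>w. f w + g w) \<in> I"
  using additive_subgroup.a_closed[OF additive_subgroup_axioms, of f g] by (simp add: free_algebra_def)

lemma zero_mem: "(\<lambda>w. 0) \<in> I"
  using additive_subgroup.zero_closed[OF additive_subgroup_axioms] by (simp add: free_algebra_def)

lemma uminus_mem: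
  assumes "f \<in> I"
  shows "(\<lambda>w. - f w) \<in> I"
proof -
  have "monomial (- 1) [] \<otimes>\<^bsub>free_algebra B\<^esub> f \<in> I"
    using assms by (intro I_l_closed monomial_closed) auto
  moreover have "(\<Sum>k\<le>length w. monomial (- 1) [] (take k w) * f (drop k w)) = - f w" for w
  proof -
    have "(\<Sum>k\<le>length w. monomial (- 1) [] (take k w) * f (drop k w))
        = (\<Sum>k\<le>length w. if k = 0 then - f w else 0)"
      by (intro sum.cong) (auto simp: monomial_def)
    then show ?thesis by simp
  qed
  ultimately show ?thesis by (simp add: free_algebra_def)
qed

lemma diff_mem: "f \<in> I \<Longrightarrow> g \<in> I \<Longrightarrow> (\<lambda>w. f w - g w) \<in> I"
  using add_mem[OF _ uminus_mem, of f g] by simp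

lemma sum_mem:
  assumes "\<And>i. i \<in> A \<Longrightarrow> h i \<in> I"
  shows "(\<lambda>w. \<Sum>i\<in>A. h i w) \<in> I"
  using assms
proof (induction A rule: infinite_finite_induct)
  case (insert i A)
  then show ?case using add_mem[of "h i" "\<lambda>w. \<Sum>i\<in>A. h i w"] by simp
qed (simp_all add: zero_mem)

lemma swap_adjacent:
  assumes "set (u @ i # j # v) \<subseteq> B"
  shows "(\<lambda>w. monomial c (u @ i # j # v) w + monomial c (u @ j # i # v) w) \<in> I"
proof -
  let ?A = "free_algebra B :: ('v list \<Rightarrow> 'f) ring"
  let ?g = "monomial 1 [i, j] \<oplus>\<^bsub>?A\<^esub> monomial 1 [j, i]"
  have carr: "monomial c u \<in> carrier ?A" "monomial 1 v \<in> carrier ?A"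
    "monomial 1 [i, j] \<in> carrier ?A" "monomial 1 [j, i] \<in> carrier ?A"
    using assms by (auto intro!: monomial_closed)
  have "?g = (\<lambda>w. monomial 1 [i, j] w + monomial 1 [j, i] w)" by (simp add: free_algebra_def)
  then have "?g \<in> I"
    using anticommutators assms unfolding anticommutators_eq by auto
  then have "monomial c u \<otimes>\<^bsub>?A\<^esub> ?g \<otimes>\<^bsub>?A\<^esub> monomial 1 v \<in> I"
    using carr by (intro I_r_closed I_l_closed)
  also have "monomial c u \<otimes>\<^bsub>?A\<^esub> ?g \<otimes>\<^bsub>?A\<^esub> monomial 1 v
      = monomial c (u @ i # j # v) \<oplus>\<^bsub>?A\<^esub> monomial c (u @ j # i # v)"
    using carr by (simp add: l_distr r_distr m_closed) (simp add: monomial_mult)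
  finally show ?thesis by (simp add: free_algebra_def)
qed

lemma move_to_front:
  assumes "set (p @ u @ a # v) \<subseteq> B"
  shows "(\<lambda>w. monomial c (p @ u @ a # v) w - monomial ((- 1) ^ length u * c) (p @ a # u @ v) w) \<in> I"
  using assms
proof (induction u arbitrary: v rule: rev_induct)
  case Nil
  then show ?case by (simp add: zero_mem)
next
  case (snoc b u)
  have "(\<lambda>w. monomial c (p @ u @ a # b # v) w
      - monomial ((- 1) ^ length u * c) (p @ a # u @ b # v) w) \<in> I"
    using snoc by simp
  moreover have "(\<lambda>w. monomial c ((p @ u) @ b # a # v) w + monomial c ((p @ u) @ a # b # v) w) \<in> I"
    using snoc.prems by (intro swap_adjacent) auto
  ultimately have "(\<lambda>w. (monomial c ((p @ u) @ b # a # v) w + monomial c ((p @ u) @ a # b # v) w)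
      - (monomial c (p @ u @ a # b # v) w - monomial ((- 1) ^ length u * c) (p @ a # u @ b # v) w)) \<in> I"
    by (rule diff_mem[rotated])
  moreover have "monomial (- d) x w = - monomial d x w" for d :: 'f and x w :: "'v list"
    by (simp add: monomial_def)
  ultimately show ?case by simp
qed

text \<open>Bring the two equal letters together. Twice a word with two equal adjacent letters is an instance
  of the relations, and \<open>2\<close> is invertible.\<close>
lemma repeated_letter_mem:
  assumes "w \<in> lists B" "\<not> distinct w"
  shows "monomial c w \<in> I"
proof -
  obtain p a q t where w: "w = p @ [a] @ q @ [a] @ t"
    using not_distinct_decomp[OF assms(2)] by blast
  let ?d = "(- 1) ^ length q * c"
  have move: "(\<lambda>x. monomial c ((p @ [a]) @ q @ a # t) x - monomial ?d ((p @ [a]) @ a # q @ t) x) \<in> I"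
    using assms(1) w by (intro move_to_front) auto
  have "(\<lambda>x. monomial (?d / 2) (p @ a # a # q @ t) x + monomial (?d / 2) (p @ a # a # q @ t) x) \<in> I"
    using assms(1) w by (intro swap_adjacent) auto
  moreover have "monomial (?d / 2) y x + monomial (?d / 2) y x = monomial ?d y x" for x y :: "'v list"
    using two_nonzero by (simp add: monomial_def field_simps)
  ultimately have "monomial ?d (p @ a # a # q @ t) \<in> I" by simp
  from add_mem[OF move this] show ?thesis by (simp add: w)
qed

text \<open>Any two arrangements of the same letters agree up to the product of their signs. By induction on the
  target word, whose first letter is moved to the front of the source word; the prefix \<open>p\<close> collects
  the letters that are already in place.\<close>
lemma rearrange:
  assumes "inj_on r B" "set (p @ w) \<subseteq> B" "distinct w" "distinct w'" "set w' = set w"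
  shows "(\<lambda>x. monomial c (p @ w) x - monomial (c * word_sign r w * word_sign r w') (p @ w') x) \<in> I"
  using assms(2-)
proof (induction w' arbitrary: p w c)
  case Nil
  then show ?case by (simp add: zero_mem)
next
  case (Cons a t)
  then obtain u v where w: "w = u @ a # v" by (metis list.set_intros(1) split_list)
  let ?d = "(- 1) ^ length u * c"
  have t: "distinct (u @ v)" "set t = set (u @ v)"
    using Cons.prems w by auto
  have "(\<lambda>x. monomial c (p @ u @ a # v) x - monomial ?d (p @ a # u @ v) x) \<in> I"
    using Cons.prems(1) w by (intro move_to_front) simp
  moreover have "(\<lambda>x. monomial ?d ((p @ [a]) @ (u @ v)) x
      - monomial (?d * word_sign r (u @ v) * word_sign r t) ((p @ [a]) @ t) x) \<in> I"
    using Cons.prems w t by (intro Cons.IH) auto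
  ultimately have mem: "(\<lambda>x. (monomial c (p @ u @ a # v) x - monomial ?d (p @ a # u @ v) x)
      + (monomial ?d ((p @ [a]) @ (u @ v)) x
      - monomial (?d * word_sign r (u @ v) * word_sign r t) ((p @ [a]) @ t) x)) \<in> I"
    by (rule add_mem)
  have sign: "c * word_sign r w * word_sign r (a # t) = ?d * word_sign r (u @ v) * word_sign r t"
  proof -
    have "inj_on r (set (u @ a # v))"
      using Cons.prems(1) w by (intro inj_on_subset[OF assms(1)]) auto
    then have "word_sign r w = (- 1) ^ length u * (crossing_sign r {a} (set t) * word_sign r (u @ v) :: 'f)"
      using word_sign_move_to_front[of u a v r, where 'f = 'f] Cons.prems w t(2) by simp
    then have "c * word_sign r w * word_sign r (a # t)
        = ?d * word_sign r (u @ v) * word_sign r t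
          * (crossing_sign r {a} (set t) * crossing_sign r {a} (set t))"
      by (simp add: mult_ac)
    then show ?thesis by (simp add: crossing_sign_square)
  qed
  show ?case unfolding sign using mem by (simp add: w)
qed

text \<open>Modulo the ideal every word is either \<open>0\<close> or a signed copy of the chosen arrangement of its letters.
  Hence \<open>f\<close> is congruent to a combination of chosen arrangements whose coefficients are, up to sign,
  those of \<open>straighten r f\<close>.\<close>
lemma straighten_kernel_subset:
  assumes r: "inj_on r B" and f: "f \<in> carrier (free_algebra B)" and zero: "straighten r f = (\<lambda>S. 0)"
  shows "f \<in> I"
proof -
  define D where "D = {w. f w \<noteq> 0}"
  have D: "finite D" "D \<subseteq> lists B" using f by (auto simp: D_def free_algebra_def)
  let ?n = "\<lambda>w. some_arrangement (set w)"
  \<comment> \<open>\<open>?e w\<close> is the normal form of the term of \<open>f\<close> at the word \<open>w\<close>\<close>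
  let ?e = "\<lambda>w. if distinct w then monomial (f w * word_sign r w * word_sign r (?n w)) (?n w) else (\<lambda>x. 0)"
  have "(\<lambda>x. monomial (f w) w x - ?e w x) \<in> I" if "w \<in> D" for w
  proof (cases "distinct w")
    case True
    have "?n w \<in> arrangements (set w)" by (simp add: some_arrangement_mem)
    then show ?thesis
      using rearrange[OF r, of "[]" w "?n w" "f w"] True D that by (auto simp: arrangements_def)
  next
    case False
    then show ?thesis using repeated_letter_mem[of w "f w"] D that by auto
  qed
  then have "(\<lambda>x. \<Sum>w\<in>D. monomial (f w) w x - ?e w x) \<in> I" by (rule sum_mem)
  moreover have "(\<Sum>w\<in>D. monomial (f w) w x - ?e w x) = f x" for x
  proof -
    have "(\<Sum>w\<in>D. monomial (f w) w x) = f x"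
      using D by (simp add: monomial_def D_def)
    moreover have "(\<Sum>w\<in>D. ?e w x) = 0"
    proof (cases "x = ?n x")
      case True
      have "(\<Sum>w\<in>D. ?e w x) = (\<Sum>w\<in>arrangements (set x). f w * word_sign r w * word_sign r x)"
      proof (rule sum.mono_neutral_cong)
        show "?e w x = 0" if "w \<in> D - arrangements (set x)" for w
          using that by (auto simp: monomial_def arrangements_def)
        show "f w * word_sign r w * word_sign r x = 0" if "w \<in> arrangements (set x) - D" for w
          using that by (simp add: D_def)
        show "?e w x = f w * word_sign r w * word_sign r x" if "w \<in> D \<inter> arrangements (set x)" for w
          using that True by (auto simp: monomial_def arrangements_def)
      qed (simp_all add: D)
      also have "\<dots> = straighten r f (set x) * word_sign r x"
        by (simp add: straighten_def sum_distrib_left sum_distrib_right mult_ac)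
      finally show ?thesis by (simp add: zero)
    next
      case False
      then have "?e w x = 0" for w by (auto simp: monomial_def)
      then show ?thesis by simp
    qed
    ultimately show ?thesis by (simp add: sum_subtractf)
  qed
  ultimately show ?thesis by simp
qed

end

lemma straighten_anticommutators:
  assumes r: "inj_on r B" and f: "f \<in> anticommutators B"
  shows "straighten r f = (\<lambda>S. 0 :: 'f::field)"
proof (rule ext)
  fix S
  obtain i j where ij: "i \<in> B" "j \<in> B" and f_eq: "f = (\<lambda>w. monomial 1 [i, j] w + monomial 1 [j, i] w)"
    using f unfolding anticommutators_eq by blast
  \<comment> \<open>the conditions are kept abstract: for \<open>i = j\<close> the words \<open>[i, j]\<close> and \<open>[j, i]\<close> coincide and both summands count\<close>
  have indicators: "c * ((if P then 1 else 0) + (if Q then 1 else 0))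
      = (if P then c else 0) + (if Q then c else 0)"
    for c :: 'f and P Q by (simp add: distrib_left)
  have "straighten r f S
      = (\<Sum>w\<in>arrangements S. (if w = [i, j] then word_sign r w else 0)
          + (if w = [j, i] then word_sign r w else 0))"
    unfolding straighten_def f_eq
    by (simp only: monomial_def indicators)
  also have "\<dots> = (if [i, j] \<in> arrangements S then word_sign r [i, j] else 0)
      + (if [j, i] \<in> arrangements S then word_sign r [j, i] else 0)"
    by (simp only: sum.distrib sum.delta finite_arrangements)
  also have "\<dots> = 0"
  proof (cases "[i, j] \<in> arrangements S")
    case True
    then have "i \<noteq> j" and ji: "[j, i] \<in> arrangements S" by (auto simp: arrangements_def)
    then have "r i \<noteq> r j" using r ij by (auto simp: inj_on_def)
    then have "word_sign r [i, j] + word_sign r [j, i] = (0 :: 'f)"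
      by (cases "r i < r j") (simp_all add: crossing_sign_def)
    then show ?thesis using True ji by simp
  next
    case False
    then have "[j, i] \<notin> arrangements S" by (auto simp: arrangements_def)
    then show ?thesis using False by simp
  qed
  finally show "straighten r f S = 0" .
qed

text \<open>The straightening map is a surjective homomorphism from the free algebra, so it remains to see that
  its kernel is exactly the ideal generated by the anticommutators.\<close>
lemma exterior_algebra_iso_grassmann:
  assumes B: "finite B" and r: "inj_on r B" and two: "(2 :: 'f::field) \<noteq> 0"
  shows "(exterior_algebra B :: ('v list \<Rightarrow> 'f) set ring)
    \<simeq> (grassmann r B :: ('v set \<Rightarrow> 'f) ring)"
proof -
  let ?A = "free_algebra B :: ('v list \<Rightarrow> 'f) ring" and ?E = "grassmann r B :: ('v set \<Rightarrow> 'f) ring"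
  interpret A: ring ?A by (rule ring_free_algebra)
  interpret E: ring ?E by (rule ring_grassmann[OF B])
  interpret st: ring_hom_ring ?A ?E "straighten r"
    by (rule ring_hom_ringI2[OF A.ring_axioms E.ring_axioms straighten_ring_hom])
  have ker: "a_kernel ?A ?E (straighten r) = {f \<in> carrier ?A. straighten r f = (\<lambda>S. 0)}"
    unfolding a_kernel_def' by (simp only: grassmann_def ring.simps)
  have kernel: "Idl\<^bsub>?A\<^esub> anticommutators B = a_kernel ?A ?E (straighten r)"
  proof (rule subset_antisym)
    have "anticommutators B \<subseteq> a_kernel ?A ?E (straighten r)"
      using anticommutators_closed[of B, where 'b = 'f] straighten_anticommutators[OF r]
      unfolding ker by blast
    then show "Idl\<^bsub>?A\<^esub> anticommutators B \<subseteq> a_kernel ?A ?E (straighten r)"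
      by (rule A.genideal_minimal[OF st.kernel_is_ideal])
  next
    have "ideal (Idl\<^bsub>?A\<^esub> anticommutators B) ?A"
      by (rule A.genideal_ideal[OF anticommutators_closed])
    then interpret ideal_with_anticommutators "Idl\<^bsub>?A\<^esub> anticommutators B" B
      using A.genideal_self[OF anticommutators_closed] two
      by (intro ideal_with_anticommutators.intro ideal_with_anticommutators_axioms.intro)
    show "a_kernel ?A ?E (straighten r) \<subseteq> Idl\<^bsub>?A\<^esub> anticommutators B"
      unfolding ker using straighten_kernel_subset[OF r] by blast
  qed
  show ?thesis
    unfolding exterior_algebra_eq kernel by (rule st.FactRing_iso[OF straighten_surj[OF B]])
qed

section \<open>The grading by cardinality\<close>

definition grassmann_degree :: "('v \<Rightarrow> nat) \<Rightarrow> 'v set \<Rightarrow> nat \<Rightarrow> ('v set \<Rightarrow> 'f::field) set" where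
  "grassmann_degree r B n = {x \<in> carrier (grassmann r B). \<forall>S. x S \<noteq> 0 \<longrightarrow> card S = n}"

lemma grassmann_mult:
  "(x \<otimes>\<^bsub>grassmann r B\<^esub> y) U = (\<Sum>S\<in>Pow U. crossing_sign r S (U - S) * x S * y (U - S))"
  by (simp add: grassmann_def)

lemma grassmann_simps:
  "x \<in> carrier (grassmann r B) \<longleftrightarrow> (\<forall>S. x S \<noteq> 0 \<longrightarrow> S \<subseteq> B)"
  "\<zero>\<^bsub>grassmann r B\<^esub> = (\<lambda>S. 0)"
  "x \<oplus>\<^bsub>grassmann r B\<^esub> y = (\<lambda>S. x S + y S)"
  by (simp_all add: grassmann_def)

text \<open>The dummy parameter of type \<open>'f itself\<close> determines the coefficient field, on which neither the set
  of generators nor its numbering depends.\<close>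
locale numbered_generators =
  fixes B :: "'v set" and r :: "'v \<Rightarrow> nat" and field_type :: "'f::field itself"
  assumes finite_generators: "finite B" and inj_numbering: "inj_on r B"
    and two_nonzero: "(2 :: 'f::field) \<noteq> 0"
begin

abbreviation E :: "('v set \<Rightarrow> 'f) ring" where "E \<equiv> grassmann r B"
abbreviation H :: "nat \<Rightarrow> ('v set \<Rightarrow> 'f) set" where "H \<equiv> grassmann_degree r B"

sublocale E: ring E by (rule ring_grassmann[OF finite_generators])

lemma uminus_E:
  assumes "x \<in> carrier E"
  shows "\<ominus>\<^bsub>E\<^esub> x = (\<lambda>S. - x S)"
proof (rule E.minus_equality)
  show "(\<lambda>S. - x S) \<oplus>\<^bsub>E\<^esub> x = \<zero>\<^bsub>E\<^esub>" by (simp add: grassmann_simps)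
  show "(\<lambda>S. - x S) \<in> carrier E" using assms by (simp add: grassmann_simps)
qed (rule assms)

lemma finsum_E:
  assumes "finite A" "\<And>i. i \<in> A \<Longrightarrow> f i \<in> carrier E"
  shows "finsum E f A = (\<lambda>S. \<Sum>i\<in>A. f i S)"
  using assms
proof (induction A)
  case (insert i A)
  then have "finsum E f (insert i A) = f i \<oplus>\<^bsub>E\<^esub> finsum E f A"
    by (intro E.finsum_insert) auto
  moreover have "finsum E f A = (\<lambda>S. \<Sum>i\<in>A. f i S)"
    using insert.prems by (intro insert.IH) auto
  ultimately show ?case using insert.hyps by (simp add: grassmann_simps)
qed (simp add: grassmann_simps)

lemma support_subset: "x \<in> carrier E \<Longrightarrow> x S \<noteq> 0 \<Longrightarrow> S \<subseteq> B"
  by (simp add: grassmann_simps)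

lemma coefficient_set_finite: "x \<in> carrier E \<Longrightarrow> x S \<noteq> 0 \<Longrightarrow> finite S \<and> card S \<le> card B"
  using support_subset[of x S] finite_generators finite_subset card_mono by blast

lemma graded: "graded_ring E H"
proof (intro graded_ring.intro graded_ring_axioms.intro E.ring_axioms)
  fix n
  show "additive_subgroup (H n) E"
  proof (rule additive_subgroup.intro, rule E.add.subgroupI)
    show "H n \<subseteq> carrier E" by (auto simp: grassmann_degree_def)
    have "(\<lambda>S. 0) \<in> H n" by (simp add: grassmann_degree_def grassmann_simps)
    then show "H n \<noteq> {}" by blast
    show "\<ominus>\<^bsub>E\<^esub> x \<in> H n" if "x \<in> H n" for x
      using that uminus_E[of x] by (simp add: grassmann_degree_def grassmann_simps)
    show "x \<oplus>\<^bsub>E\<^esub> y \<in> H n" if "x \<in> H n" "y \<in> H n" for x y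
    proof -
      have "x S \<noteq> 0 \<or> y S \<noteq> 0" if "x S + y S \<noteq> 0" for S using that by auto
      then show ?thesis using that unfolding grassmann_degree_def grassmann_simps by blast
    qed
  qed
next
  fix x assume x: "x \<in> carrier E"
  let ?P = "\<lambda>f. (\<forall>n. f n \<in> H n) \<and> finite {n. f n \<noteq> \<zero>\<^bsub>E\<^esub>} \<and> x = (\<Oplus>\<^bsub>E\<^esub>n\<in>{n. f n \<noteq> \<zero>\<^bsub>E\<^esub>}. f n)"
  define f where "f n = (\<lambda>S. if card S = n then x S else 0)" for n
  show "\<exists>!f. ?P f"
  proof (rule ex1I)
    have f: "f n \<in> H n" for n using x by (simp add: f_def grassmann_degree_def grassmann_simps)
    have "{n. f n \<noteq> \<zero>\<^bsub>E\<^esub>} \<subseteq> {..card B}"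
      using coefficient_set_finite[OF x] by (auto simp: f_def grassmann_simps fun_eq_iff)
    then have fin: "finite {n. f n \<noteq> \<zero>\<^bsub>E\<^esub>}" using finite_subset by blast
    have "(\<Sum>n\<in>{n. f n \<noteq> \<zero>\<^bsub>E\<^esub>}. f n S) = x S" for S
    proof -
      have "(\<Sum>n\<in>{n. f n \<noteq> \<zero>\<^bsub>E\<^esub>}. f n S) = (\<Sum>n\<in>{card S}. f n S)"
      proof (intro sum.mono_neutral_cong fin)
        show "f n S = 0" if "n \<in> {card S} - {n. f n \<noteq> \<zero>\<^bsub>E\<^esub>}" for n
        proof -
          have "f n = (\<lambda>S. 0)" using that unfolding grassmann_simps by blast
          then show ?thesis by simp
        qed
      qed (auto simp: f_def)
      then show ?thesis by (simp add: f_def)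
    qed
    moreover have "f n \<in> carrier E" for n using f by (simp add: grassmann_degree_def)
    ultimately have "(\<Oplus>\<^bsub>E\<^esub>n\<in>{n. f n \<noteq> \<zero>\<^bsub>E\<^esub>}. f n) = x" by (simp add: finsum_E[OF fin])
    then show "?P f" using f fin by simp
  next
    fix g assume g: "?P g"
    have gH: "g n S \<noteq> 0 \<Longrightarrow> card S = n" and gE: "g n \<in> carrier E" for n S
      using g by (auto simp: grassmann_degree_def)
    have "g n S = f n S" for n S
    proof -
      have "x S = (\<Sum>n\<in>{n. g n \<noteq> \<zero>\<^bsub>E\<^esub>}. g n S)"
        using g gE finsum_E[of "{n. g n \<noteq> \<zero>\<^bsub>E\<^esub>}" g] by metis
      also have "\<dots> = (\<Sum>n\<in>{card S}. g n S)"
        using g gH by (intro sum.mono_neutral_cong) (auto simp: grassmann_simps)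
      finally show ?thesis using gH[of n S] by (auto simp: f_def)
    qed
    then show "g = f" by (intro ext)
  qed
next
  fix x y m n assume x: "x \<in> H m" and y: "y \<in> H n"
  have "card U = m + n" if nz: "(x \<otimes>\<^bsub>E\<^esub> y) U \<noteq> 0" for U
  proof -
    obtain S where S: "S \<in> Pow U" "crossing_sign r S (U - S) * x S * y (U - S) \<noteq> 0"
      using nz unfolding grassmann_mult by (rule sum.not_neutral_contains_not_neutral)
    then have "x S \<noteq> 0" "y (U - S) \<noteq> 0" by auto
    note S = S(1) this
    have "finite S" "finite (U - S)"
      using x y S coefficient_set_finite by (auto simp: grassmann_degree_def)
    then have "card (S \<union> (U - S)) = card S + card (U - S)" by (intro card_Un_disjoint) auto
    moreover have "S \<union> (U - S) = U" using S by blast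
    ultimately show ?thesis using x y S by (simp add: grassmann_degree_def)
  qed
  moreover have "x \<otimes>\<^bsub>E\<^esub> y \<in> carrier E" using x y by (auto simp: grassmann_degree_def)
  ultimately show "x \<otimes>\<^bsub>E\<^esub> y \<in> H (m + n)" by (simp add: grassmann_degree_def)
qed

text \<open>Passing from \<open>S\<close> to its complement \<open>U - S\<close> matches the terms of \<open>y x\<close> at \<open>U\<close> with those of \<open>x y\<close>,
  and each pair differs by the sign of a swap of the two sets.\<close>
lemma generalized_anticommutative: "generalized_anticommutative E H"
  unfolding generalized_anticommutative_def
proof (intro allI ballI)
  fix m n x y assume x: "x \<in> H m" and y: "y \<in> H n"
  have carr: "x \<in> carrier E" "y \<in> carrier E" using x y by (auto simp: grassmann_degree_def)
  have "(y \<otimes>\<^bsub>E\<^esub> x) U = (- 1) ^ (m * n) * (x \<otimes>\<^bsub>E\<^esub> y) U" for U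
  proof -
    have "(y \<otimes>\<^bsub>E\<^esub> x) U = (\<Sum>S\<in>Pow U. crossing_sign r (U - S) S * y (U - S) * x S)"
      unfolding grassmann_mult
      by (rule sum.reindex_bij_witness[where i = "\<lambda>S. U - S" and j = "\<lambda>S. U - S"])
        (auto simp: double_diff)
    also have "\<dots> = (\<Sum>S\<in>Pow U. (- 1) ^ (m * n) * (crossing_sign r S (U - S) * x S * y (U - S)))"
    proof (intro sum.cong refl)
      fix S assume S: "S \<in> Pow U"
      show "crossing_sign r (U - S) S * y (U - S) * x S
          = (- 1) ^ (m * n) * (crossing_sign r S (U - S) * x S * y (U - S))"
      proof (cases "x S = 0 \<or> y (U - S) = 0")
        case False
        then have "card S = m" "card (U - S) = n"
          using x y by (auto simp: grassmann_degree_def)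
        moreover have "S \<subseteq> B" "U - S \<subseteq> B"
          using False support_subset carr by blast+
        ultimately have "crossing_sign r (U - S) S = ((- 1) ^ (m * n) * crossing_sign r S (U - S) :: 'f)"
          using crossing_sign_swap[of r S "U - S"] inj_on_subset[OF inj_numbering, of "S \<union> (U - S)"] by auto
        then show ?thesis by (simp add: mult_ac)
      qed auto
    qed
    also have "\<dots> = (- 1) ^ (m * n) * (x \<otimes>\<^bsub>E\<^esub> y) U"
      by (simp add: grassmann_mult sum_distrib_left)
    finally show ?thesis .
  qed
  then have "y \<otimes>\<^bsub>E\<^esub> x = (\<lambda>U. (- 1) ^ (m * n) * (x \<otimes>\<^bsub>E\<^esub> y) U)" by (intro ext)
  then show "y \<otimes>\<^bsub>E\<^esub> x = (\<ominus>\<^bsub>E\<^esub> \<one>\<^bsub>E\<^esub>) [^]\<^bsub>E\<^esub> (m * n) \<otimes>\<^bsub>E\<^esub> (x \<otimes>\<^bsub>E\<^esub> y)"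
    using carr uminus_E[of "x \<otimes>\<^bsub>E\<^esub> y"] by (simp add: E.minus_one_pow E.l_minus)
qed

lemma degree_nonzero_iff: "H n \<noteq> {\<zero>\<^bsub>E\<^esub>} \<longleftrightarrow> n \<le> card B"
proof
  assume "n \<le> card B"
  then obtain S where S: "S \<subseteq> B" "card S = n" using obtain_subset_with_card_n by metis
  define x :: "'v set \<Rightarrow> 'f" where "x U = (if U = S then 1 else 0)" for U
  have "x \<in> H n" "x S \<noteq> \<zero>\<^bsub>E\<^esub> S" using S by (auto simp: x_def grassmann_degree_def grassmann_simps)
  then show "H n \<noteq> {\<zero>\<^bsub>E\<^esub>}" by auto
next
  assume "H n \<noteq> {\<zero>\<^bsub>E\<^esub>}"
  moreover have "\<zero>\<^bsub>E\<^esub> \<in> H n" by (simp add: grassmann_degree_def grassmann_simps)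
  ultimately obtain x where x: "x \<in> H n" "x \<noteq> \<zero>\<^bsub>E\<^esub>" by blast
  then obtain S where "x S \<noteq> 0" by (auto simp: grassmann_simps)
  with x show "n \<le> card B" using coefficient_set_finite[of x S] by (auto simp: grassmann_degree_def)
qed

text \<open>If the coefficient of \<open>x\<close> at \<open>S\<close> is nonzero, multiply by the monomial of an \<open>n\<close>-element set \<open>T\<close> disjoint
  from \<open>S\<close>. No other term of \<open>x\<close> contributes to the coefficient at \<open>S \<union> T\<close>, so nothing cancels.\<close>
lemma homogeneously_faithful: "homogeneously_faithful E H"
  unfolding homogeneously_faithful_def
proof (intro allI impI conjI ballI)
  fix m n assume nz: "H (m + n) \<noteq> {\<zero>\<^bsub>E\<^esub>}"
  then have le: "m + n \<le> card B" using degree_nonzero_iff by blast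
  then have "m \<le> card B" by simp
  then show "H m \<noteq> {\<zero>\<^bsub>E\<^esub>}" using degree_nonzero_iff by blast
  fix x assume x: "x \<in> H m - {\<zero>\<^bsub>E\<^esub>}"
  then obtain S where S: "x S \<noteq> 0" by (auto simp: grassmann_simps)
  have SB: "S \<subseteq> B" "card S = m" using x S by (auto simp: grassmann_degree_def grassmann_simps)
  then have "n \<le> card (B - S)"
    using le finite_generators finite_subset[of S B] by (simp add: card_Diff_subset)
  then obtain T where T: "T \<subseteq> B - S" "card T = n" using obtain_subset_with_card_n by metis
  define y :: "'v set \<Rightarrow> 'f" where "y U = (if U = T then 1 else 0)" for U
  have y: "y \<in> H n" using T by (auto simp: y_def grassmann_degree_def grassmann_simps)
  have fin: "finite (S \<union> T)" using SB T finite_generators by (meson Diff_subset finite_UnI finite_subset)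
  have "(x \<otimes>\<^bsub>E\<^esub> y) (S \<union> T)
      = (\<Sum>S'\<in>Pow (S \<union> T). if S' = S then crossing_sign r S T * x S else 0)"
    unfolding grassmann_mult
  proof (intro sum.cong refl)
    fix S' assume "S' \<in> Pow (S \<union> T)"
    then have "S \<union> T - S' = T \<longleftrightarrow> S' = S" using T by blast
    then show "crossing_sign r S' (S \<union> T - S') * x S' * y (S \<union> T - S')
        = (if S' = S then crossing_sign r S T * x S else 0)"
      by (auto simp: y_def)
  qed
  also have "\<dots> = crossing_sign r S T * x S" using fin by simp
  finally have "(x \<otimes>\<^bsub>E\<^esub> y) (S \<union> T) \<noteq> 0" using S by (simp add: crossing_sign_nonzero)
  then have "x \<otimes>\<^bsub>E\<^esub> y \<noteq> \<zero>\<^bsub>E\<^esub>" by (auto simp: grassmann_simps)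
  then show "(\<lambda>y. x \<otimes>\<^bsub>E\<^esub> y) ` H n \<noteq> {\<zero>\<^bsub>E\<^esub>}" using y by blast
qed

lemma no_additive_2_torsion: "no_additive_2_torsion E"
  unfolding no_additive_2_torsion_def grassmann_simps
proof (intro ballI impI ext)
  fix x :: "'v set \<Rightarrow> 'f" and S assume "(\<lambda>S. x S + x S) = (\<lambda>S. 0)"
  then have "2 * x S = 0" by (metis mult_2)
  then show "x S = 0" using two_nonzero by simp
qed

sublocale faithful_anticommutative_ring E H
  by (intro faithful_anticommutative_ring.intro faithful_anticommutative_ring_axioms.intro graded
      generalized_anticommutative homogeneously_faithful no_additive_2_torsion)

text \<open>Degree \<open>n\<close> is nonzero exactly for \<open>n \<le> card B\<close>, so the only degree \<open>n\<close> with a nonzero component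
  followed by a zero one is \<open>card B\<close>.\<close>
lemma centrally_essential_iff_odd_card:
  assumes "card B > 0"
  shows "centrally_essential E \<longleftrightarrow> odd (card B)"
proof -
  have "carrier E \<noteq> H 0"
  proof
    assume "carrier E = H 0"
    have "H 1 \<noteq> {\<zero>\<^bsub>E\<^esub>}" using assms degree_nonzero_iff[of 1] by simp
    then obtain x where x: "x \<in> H 1" "x \<noteq> \<zero>\<^bsub>E\<^esub>" using zero_homogeneous[of 1] by blast
    then obtain S where "x S \<noteq> 0" by (auto simp: grassmann_simps)
    moreover have "x \<in> H 0" using x \<open>carrier E = H 0\<close> homogeneous_closed by blast
    ultimately show False using x by (auto simp: grassmann_degree_def)
  qed
  moreover have top: "H (n + 1) = {\<zero>\<^bsub>E\<^esub>} \<longleftrightarrow> card B \<le> n" for n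
    using degree_nonzero_iff[of "n + 1"] by (metis Suc_eq_plus1 not_less_eq_eq)
  ultimately have "centrally_essential E \<longleftrightarrow> (\<exists>n. odd n \<and> n \<le> card B \<and> card B \<le> n)"
    unfolding centrally_essential_iff_odd_top top degree_nonzero_iff by blast
  also have "\<dots> \<longleftrightarrow> odd (card B)"
    by (metis le_antisym order_refl)
  finally show ?thesis .
qed

lemma not_cring_E: "card B > 1 \<Longrightarrow> \<not> cring E"
  using not_cring_if_degree_2 degree_nonzero_iff by auto

lemma exterior_algebra_iso: "(exterior_algebra B :: ('v list \<Rightarrow> 'f) set ring) \<simeq> E"
  using exterior_algebra_iso_grassmann[OF finite_generators inj_numbering two_nonzero] .

lemma finite_carrier_E:
  assumes "finite (UNIV :: 'f set)"
  shows "finite (carrier E)"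
proof -
  have "carrier E \<subseteq> {x. \<forall>S. (S \<in> Pow B \<longrightarrow> x S \<in> UNIV) \<and> (S \<notin> Pow B \<longrightarrow> x S = 0)}"
    using support_subset by blast
  moreover have "finite \<dots>"
    using finite_generators assms by (intro finite_set_of_finite_funs) auto
  ultimately show ?thesis by (rule finite_subset)
qed

end

section \<open>Exterior algebras\<close>

lemma cring_ring_iso:
  assumes "cring R" "ring S" "R \<simeq> S"
  shows "cring S"
proof -
  obtain h where h: "h \<in> ring_iso R S" using assms(3) by (auto simp: is_ring_iso_def)
  interpret R: cring R by (rule assms)
  interpret S: ring S by (rule assms)
  have "h \<zero>\<^bsub>R\<^esub> = \<zero>\<^bsub>S\<^esub>"
    using ring_hom_zero[of h R S] h R.ring_axioms S.ring_axioms by (simp add: ring_iso_def)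
  then show ?thesis using R.ring_iso_imp_img_cring[OF h] by simp
qed

lemma finite_carrier_ring_iso:
  assumes "R \<simeq> S" "finite (carrier S)"
  shows "finite (carrier R)"
  using assms by (auto simp: is_ring_iso_def ring_iso_def bij_betw_finite)

text \<open>The numbering of the generators is auxiliary: any injection of the finite set \<open>B\<close> into the natural
  numbers serves.\<close>
theorem exterior_algebra_properties:
  fixes B :: "'v set"
  assumes B: "finite B" and two: "(2 :: 'f::field) \<noteq> 0"
  defines "E \<equiv> exterior_algebra B :: ('v list \<Rightarrow> 'f) set ring"
  shows exterior_centrally_essential_iff: "card B > 0 \<Longrightarrow> centrally_essential E \<longleftrightarrow> odd (card B)"
    and exterior_noncommutative: "card B > 1 \<Longrightarrow> \<not> cring E"
    and exterior_finite: "finite (UNIV :: 'f set) \<Longrightarrow> finite (carrier E)"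
proof -
  obtain r :: "'v \<Rightarrow> nat" where r: "inj_on r B"
    using finite_imp_inj_to_nat_seg[OF B] by blast
  interpret G: numbered_generators B r "TYPE('f)"
    using B r two by (rule numbered_generators.intro)
  have E: "ring E" unfolding E_def by (rule ring_exterior_algebra)
  have iso: "E \<simeq> G.E" unfolding E_def by (rule G.exterior_algebra_iso)
  have osi: "G.E \<simeq> E" by (rule ring_iso_sym[OF E iso])
  show "centrally_essential E \<longleftrightarrow> odd (card B)" if "card B > 0"
    using centrally_essential_ring_iso[OF E G.E.ring_axioms iso]
      centrally_essential_ring_iso[OF G.E.ring_axioms E osi] G.centrally_essential_iff_odd_card[OF that]
    by blast
  show "\<not> cring E" if "card B > 1"
    using cring_ring_iso[OF _ G.E.ring_axioms iso] G.not_cring_E[OF that] by blast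
  show "finite (carrier E)" if "finite (UNIV :: 'f set)"
    using finite_carrier_ring_iso[OF iso G.finite_carrier_E[OF that]] .
qed

text \<open>Elements of a finite ring can be renamed to natural numbers, which gives an example over a fixed
  type of elements.\<close>
lemma finite_ring_iso_nat_ring:
  assumes "ring R" "finite (carrier R)"
  obtains S :: "nat ring" where "ring S" "R \<simeq> S" "finite (carrier S)"
proof -
  obtain f :: "'a \<Rightarrow> nat" where f: "inj_on f (carrier R)"
    using finite_imp_inj_to_nat_seg[OF assms(2)] by blast
  show ?thesis
  proof
    show "ring (image_ring f R)" by (rule ring.inj_imp_image_ring_is_ring[OF assms(1) f])
    show "R \<simeq> image_ring f R" using inj_imp_image_ring_iso[OF f] by (auto simp: is_ring_iso_def)
    show "finite (carrier (image_ring f R))" using assms(2) by (simp add: image_ring_carrier)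
  qed
qed

lemma two_nonzero_finite_3: "(2 :: Enum.finite_3) \<noteq> 0"
proof -
  have "(2 :: Enum.finite_3) = 1 + 1" by (rule one_add_one[symmetric])
  then show ?thesis by (simp add: plus_finite_3_def)
qed

text \<open>The exterior algebra of a three-dimensional space over the field with three elements, the smallest
  choice that the criterion allows: the dimension has to be odd and greater than \<open>1\<close>, the
  characteristic different from \<open>2\<close>.\<close>
lemma exists_finite_noncommutative_centrally_essential_ring:
  "\<exists>R :: nat ring. centrally_essential R \<and> \<not> cring R \<and> finite (carrier R)"
proof -
  define E where "E = (exterior_algebra {0, 1, 2} :: (nat list \<Rightarrow> Enum.finite_3) set ring)"
  have B: "finite {0, 1, 2 :: nat}" "card {0, 1, 2 :: nat} = 3" by auto
  note properties = exterior_algebra_properties[OF B(1) two_nonzero_finite_3, folded E_def]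
  have E: "ring E" unfolding E_def by (rule ring_exterior_algebra)
  have "centrally_essential E" "\<not> cring E" "finite (carrier E)"
    using properties by (simp_all add: B)
  then obtain S :: "nat ring" where S: "ring S" "E \<simeq> S" "finite (carrier S)"
    using finite_ring_iso_nat_ring[OF E] by blast
  have "centrally_essential S"
    using centrally_essential_ring_iso[OF E S(1,2)] \<open>centrally_essential E\<close> .
  moreover have "\<not> cring S"
    using cring_ring_iso[OF _ E ring_iso_sym[OF E S(2)]] \<open>\<not> cring E\<close> by blast
  ultimately show ?thesis using S(3) by blast
qed

theorem theorem1:
  shows "(\<forall>(R :: ('a, 'm) ring_scheme) (G :: nat \<Rightarrow> 'a set).
            graded_ring R G \<and> generalized_anticommutative R G \<and> homogeneously_faithful R G \<and>
            no_additive_2_torsion R \<longrightarrow>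
            (centrally_essential R \<longleftrightarrow>
               carrier R = G 0 \<or> (\<exists>n. odd n \<and> G n \<noteq> {\<zero>\<^bsub>R\<^esub>} \<and> G (n + 1) = {\<zero>\<^bsub>R\<^esub>})))
       \<and> (\<forall>(scale :: 'f::field \<Rightarrow> 'v::ab_group_add \<Rightarrow> 'v) (B :: 'v set).
            finite_dimensional_vector_space scale B \<and> CHAR('f) \<noteq> 2 \<and>
            vector_space.dim scale (UNIV :: 'v set) > 0 \<longrightarrow>
            (centrally_essential (exterior_algebra B :: ('v list \<Rightarrow> 'f) set ring) \<longleftrightarrow>
               odd (vector_space.dim scale (UNIV :: 'v set)))
            \<and> (finite (UNIV :: 'f set) \<and> odd CHAR('f) \<and>
               odd (vector_space.dim scale (UNIV :: 'v set)) \<and>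
               vector_space.dim scale (UNIV :: 'v set) > 1 \<longrightarrow>
               centrally_essential (exterior_algebra B :: ('v list \<Rightarrow> 'f) set ring) \<and>
               \<not> cring (exterior_algebra B :: ('v list \<Rightarrow> 'f) set ring) \<and>
               finite (carrier (exterior_algebra B :: ('v list \<Rightarrow> 'f) set ring))))
       \<and> (\<exists>R :: nat ring. centrally_essential R \<and> \<not> cring R \<and> finite (carrier R))"
proof (intro conjI[OF _ conjI[OF _ exists_finite_noncommutative_centrally_essential_ring]] allI impI)
  fix R :: "('a, 'm) ring_scheme" and G :: "nat \<Rightarrow> 'a set"
  assume "graded_ring R G \<and> generalized_anticommutative R G \<and> homogeneously_faithful R G \<and>
    no_additive_2_torsion R"
  then interpret faithful_anticommutative_ring R G
    by (simp add: faithful_anticommutative_ring_def faithful_anticommutative_ring_axioms_def)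
  show "centrally_essential R \<longleftrightarrow>
      carrier R = G 0 \<or> (\<exists>n. odd n \<and> G n \<noteq> {\<zero>\<^bsub>R\<^esub>} \<and> G (n + 1) = {\<zero>\<^bsub>R\<^esub>})"
    by (rule centrally_essential_iff_odd_top)
next
  fix scale :: "'f::field \<Rightarrow> 'v::ab_group_add \<Rightarrow> 'v" and B :: "'v set"
  let ?dim = "vector_space.dim scale (UNIV :: 'v set)"
    and ?E = "exterior_algebra B :: ('v list \<Rightarrow> 'f) set ring"
  assume asm: "finite_dimensional_vector_space scale B \<and> CHAR('f) \<noteq> 2 \<and> ?dim > 0"
  then interpret V: finite_dimensional_vector_space scale B by blast
  have dim: "?dim = card B"
    using V.dim_eq_card[of B UNIV] V.span_Basis V.independent_Basis by simp
  have "(2 :: 'f) \<noteq> 0"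
  proof
    \<comment> \<open>the characteristic of a field is not \<open>1\<close>, so \<open>2 = 0\<close> would force it to be \<open>2\<close>\<close>
    assume "(2 :: 'f) = 0"
    then have "of_nat 2 = (0 :: 'f)" by simp
    then have "CHAR('f) dvd 2" by (simp only: of_nat_eq_0_iff_char_dvd)
    then have "CHAR('f) = 1 \<or> CHAR('f) = 2" by (metis prime_nat_iff two_is_prime_nat)
    then show False using asm by auto
  qed
  note two = this
  have ce: "centrally_essential ?E \<longleftrightarrow> odd ?dim"
    unfolding dim
    by (rule exterior_centrally_essential_iff[OF V.finite_Basis two]) (use asm dim in simp)
  have noncomm: "\<not> cring ?E" if "?dim > 1"
    by (rule exterior_noncommutative[OF V.finite_Basis two]) (use that dim in simp)
  have fin: "finite (carrier ?E)" if "finite (UNIV :: 'f set)"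
    by (rule exterior_finite[OF V.finite_Basis two that])
  show "(centrally_essential ?E \<longleftrightarrow> odd ?dim) \<and>
      (finite (UNIV :: 'f set) \<and> odd CHAR('f) \<and> odd ?dim \<and> ?dim > 1 \<longrightarrow>
        centrally_essential ?E \<and> \<not> cring ?E \<and> finite (carrier ?E))"
    using ce noncomm fin by simp
qed

end
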